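(* Let $u_{n,m_n}^\delta$ be defined by $$u_{n,m_n}^\delta=q\,u_{n-1,m_{n-1}}^\delta+(1-q)T_{a_n,m_n}^{-1}K_{m_n}^*f_\delta,\qquad u_{0,m_0}^\delta=0,$$ let the parameters $m_i$, $i=1,2,\dots$, be chosen so that for all $i\ge1$ $$\|T-T^{(m_i)}\|\le \frac{a_i}{2},\qquad \|T^{(m_i)}-K_{m_i}^*K\|\le a_i^2,\qquad \|K_{m_i}^*-K^*\|\le \frac{\sqrt{a_i}}{2},$$ and let the integers $n_\delta$ satisfy $$\lim_{\delta\to0}n_\delta=\infty,\qquad \lim_{\delta\to0}\frac{\delta}{\sqrt{a_{n_\delta}}}=0.$$ Then $$\lim_{\delta\to0}\|u_{n_\delta,m_{n_\delta}}^\delta-y\|=0.$$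
   Context: $K:L^2[c,d]\to L^2[c,d]$ is the compact linear operator $(Ku)(x)=\int_c^d k(x,z)u(z)\,dz$ with smooth kernel $k$ on $[c,d]\times[c,d]$; $\mathcal N(K)$ is its nullspace and $K^*$ its adjoint. The element $y$ satisfies $Ky=f$ and $y\perp\mathcal N(K)$ (the minimal-norm solution). For each noise level $\delta>0$, $f_\delta\in L^2[c,d]$ satisfies $\|f_\delta-f\|\le\delta$. Norms are the $L^2[c,d]$ norm and the corresponding operator norm. $q\in(0,1)$ and $\alpha_0>0$ are constants, $a_n:=\alpha_0q^n$. $T:=K^*K$. For each $m$, $T^{(m)}$ and $K_m^*$ are finite-rank bounded linear operators on $L^2[c,d]$ approximating $T$ and $K^*$ respectively, with $\lim_{m\to\infty}\|T^{(m)}-T\|=0$ and $\lim_{m\to\infty}\|K_m^*-K^*\|=0$ ($K_m^*$ is just the notation for the operator approximating $K^*$). $T_{a,m}:=T^{(m)}+aI$ for $a>0$. *)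

theory Defs
  imports "HOL-Analysis.Analysis"
begin

text \<open>The scalar field is real or complex. The two axioms determine the conjugation
  (it maps \<open>x \<noteq> 0\<close> to \<open>of_real ((norm x)\<^sup>2) / x\<close>), hence it is multiplicative,
  involutive and fixes the real scalars.\<close>

class conj_scalar = real_normed_field + banach + second_countable_topology +
  fixes sconj :: "'a \<Rightarrow> 'a"
  assumes sconj_add: "sconj (x + y) = sconj x + sconj y"
    and mult_sconj: "x * sconj x = ((norm x)\<^sup>2) *\<^sub>R 1"

instantiation real :: conj_scalar
begin
definition sconj_real :: "real \<Rightarrow> real" where "sconj_real x = x"
instance
  by standard (simp_all add: sconj_real_def power2_eq_square)
end

instantiation complex :: conj_scalar
begin
definition sconj_complex :: "complex \<Rightarrow> complex" where "sconj_complex x = cnj x"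
instance
  by standard (simp_all add: sconj_complex_def complex_norm_square scaleR_conv_of_real del: of_real_power)
end

text \<open>Elements of \<open>L\<^sup>2\<close> are represented by square-integrable functions; equality in
  \<open>L\<^sup>2\<close> is equality almost everywhere.\<close>

definition L2 :: "'b measure \<Rightarrow> ('b \<Rightarrow> 'a::conj_scalar) set" where
  "L2 M = {u \<in> borel_measurable M. integrable M (\<lambda>x. (norm (u x))\<^sup>2)}"

definition l2_norm :: "'b measure \<Rightarrow> ('b \<Rightarrow> 'a::conj_scalar) \<Rightarrow> real" where
  "l2_norm M u = sqrt (LINT x|M. (norm (u x))\<^sup>2)"

definition l2_inner :: "'b measure \<Rightarrow> ('b \<Rightarrow> 'a::conj_scalar) \<Rightarrow> ('b \<Rightarrow> 'a) \<Rightarrow> 'a" where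
  "l2_inner M u v = (LINT x|M. u x * sconj (v x))"

definition l2_eq :: "'b measure \<Rightarrow> ('b \<Rightarrow> 'a::conj_scalar) \<Rightarrow> ('b \<Rightarrow> 'a) \<Rightarrow> bool" where
  "l2_eq M u v \<longleftrightarrow> (AE x in M. u x = v x)"

text \<open>Linearity is required almost everywhere. Together with boundedness it implies that
  the operator respects almost-everywhere equality, so it acts on the classes.\<close>

definition bounded_op :: "'b measure \<Rightarrow> (('b \<Rightarrow> 'a::conj_scalar) \<Rightarrow> ('b \<Rightarrow> 'a)) \<Rightarrow> bool" where
  "bounded_op M A \<longleftrightarrow>
     (\<forall>u\<in>L2 M. A u \<in> L2 M) \<and>
     (\<forall>u\<in>L2 M. \<forall>v\<in>L2 M. l2_eq M (A (\<lambda>x. u x + v x)) (\<lambda>x. A u x + A v x)) \<and>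
     (\<forall>s. \<forall>u\<in>L2 M. l2_eq M (A (\<lambda>x. s * u x)) (\<lambda>x. s * A u x)) \<and>
     (\<exists>C. \<forall>u\<in>L2 M. l2_norm M (A u) \<le> C * l2_norm M u)"

definition finite_rank :: "'b measure \<Rightarrow> (('b \<Rightarrow> 'a::conj_scalar) \<Rightarrow> ('b \<Rightarrow> 'a)) \<Rightarrow> bool" where
  "finite_rank M A \<longleftrightarrow>
     (\<exists>B. finite B \<and> B \<subseteq> L2 M \<and>
       (\<forall>u\<in>L2 M. \<exists>s. l2_eq M (A u) (\<lambda>x. \<Sum>\<phi>\<in>B. s \<phi> * \<phi> x)))"

definition op_diff ::
  "(('b \<Rightarrow> 'a::conj_scalar) \<Rightarrow> ('b \<Rightarrow> 'a)) \<Rightarrow> (('b \<Rightarrow> 'a) \<Rightarrow> ('b \<Rightarrow> 'a)) \<Rightarrow> ('b \<Rightarrow> 'a) \<Rightarrow> ('b \<Rightarrow> 'a)"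
  where "op_diff A B = (\<lambda>u x. A u x - B u x)"

definition op_shift ::
  "(('b \<Rightarrow> 'a::conj_scalar) \<Rightarrow> ('b \<Rightarrow> 'a)) \<Rightarrow> real \<Rightarrow> ('b \<Rightarrow> 'a) \<Rightarrow> ('b \<Rightarrow> 'a)"
  where "op_shift A r = (\<lambda>u x. A u x + of_real r * u x)"

text \<open>Only meaningful when \<open>bounded_op M A\<close> holds or \<open>A\<close> is a difference of such operators.\<close>

definition op_norm :: "'b measure \<Rightarrow> (('b \<Rightarrow> 'a::conj_scalar) \<Rightarrow> ('b \<Rightarrow> 'a)) \<Rightarrow> real" where
  "op_norm M A = (SUP u\<in>{u \<in> L2 M. l2_norm M u \<le> 1}. l2_norm M (A u))"

text \<open>Only meaningful when \<open>A\<close> is bijective on the almost-everywhere classes; the value is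
  then a representative of the unique preimage class of \<open>g\<close>.\<close>

definition op_inv ::
  "'b measure \<Rightarrow> (('b \<Rightarrow> 'a::conj_scalar) \<Rightarrow> ('b \<Rightarrow> 'a)) \<Rightarrow> ('b \<Rightarrow> 'a) \<Rightarrow> ('b \<Rightarrow> 'a)" where
  "op_inv M A g = (SOME w. w \<in> L2 M \<and> l2_eq M (A w) g)"

definition is_adjoint ::
  "'b measure \<Rightarrow> (('b \<Rightarrow> 'a::conj_scalar) \<Rightarrow> ('b \<Rightarrow> 'a)) \<Rightarrow> (('b \<Rightarrow> 'a) \<Rightarrow> ('b \<Rightarrow> 'a)) \<Rightarrow> bool" where
  "is_adjoint M A B \<longleftrightarrow> bounded_op M B \<and>
     (\<forall>u\<in>L2 M. \<forall>v\<in>L2 M. l2_inner M (A u) v = l2_inner M u (B v))"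

definition nullspace :: "'b measure \<Rightarrow> (('b \<Rightarrow> 'a::conj_scalar) \<Rightarrow> ('b \<Rightarrow> 'a)) \<Rightarrow> ('b \<Rightarrow> 'a) set" where
  "nullspace M A = {v \<in> L2 M. l2_eq M (A v) (\<lambda>x. 0)}"

definition integral_op ::
  "'b measure \<Rightarrow> ('b \<Rightarrow> 'b \<Rightarrow> 'a::conj_scalar) \<Rightarrow> ('b \<Rightarrow> 'a) \<Rightarrow> ('b \<Rightarrow> 'a)" where
  "integral_op M k u = (\<lambda>x. LINT z|M. k x z * u z)"

text \<open>\<open>k\<close> is \<open>C\<^sup>\<infinity>\<close> on the closed square: \<open>D i j\<close> is the partial derivative of order \<open>i\<close> in the
  first and \<open>j\<close> in the second variable, one-sided at the boundary and continuous up to it.\<close>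

definition smooth_kernel :: "real \<Rightarrow> real \<Rightarrow> (real \<Rightarrow> real \<Rightarrow> 'a::real_normed_vector) \<Rightarrow> bool" where
  "smooth_kernel c d k \<longleftrightarrow>
     (\<exists>D :: nat \<Rightarrow> nat \<Rightarrow> real \<Rightarrow> real \<Rightarrow> 'a.
        (\<forall>x\<in>{c..d}. \<forall>z\<in>{c..d}. D 0 0 x z = k x z) \<and>
        (\<forall>i j. continuous_on ({c..d} \<times> {c..d}) (\<lambda>(x, z). D i j x z)) \<and>
        (\<forall>i j. \<forall>x\<in>{c..d}. \<forall>z\<in>{c..d}.
           ((\<lambda>s. D i j s z) has_vector_derivative D (Suc i) j x z) (at x within {c..d}) \<and>
           ((\<lambda>s. D i j x s) has_vector_derivative D i (Suc j) x z) (at z within {c..d})))"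

primrec iterate ::
  "'b measure \<Rightarrow> real \<Rightarrow> (nat \<Rightarrow> real) \<Rightarrow> (nat \<Rightarrow> ('b \<Rightarrow> 'a::conj_scalar) \<Rightarrow> ('b \<Rightarrow> 'a)) \<Rightarrow>
   (nat \<Rightarrow> ('b \<Rightarrow> 'a) \<Rightarrow> ('b \<Rightarrow> 'a)) \<Rightarrow> (nat \<Rightarrow> nat) \<Rightarrow> ('b \<Rightarrow> 'a) \<Rightarrow> nat \<Rightarrow> ('b \<Rightarrow> 'a)" where
  "iterate M q a Tm Km m g 0 = (\<lambda>x. 0)"
| "iterate M q a Tm Km m g (Suc n) =
     (\<lambda>x. of_real q * iterate M q a Tm Km m g n x +
          of_real (1 - q) *
            op_inv M (op_shift (Tm (m (Suc n))) (a (Suc n))) (Km (m (Suc n)) g) x)"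

end

theory Submission
  imports Defs
begin

text \<open>Every iterate is a convex combination of the regularized solutions
  \<open>w\<^sub>i = (T\<^sub>i + a\<^sub>i I)\<^sup>-\<^sup>1 K\<^sub>i\<^sup>* f\<^sub>\<delta>\<close> and of 0, where \<open>T\<^sub>i\<close> and \<open>K\<^sub>i\<^sup>*\<close> are the approximations used in step \<open>i\<close>.
  The weights concentrate on large \<open>i\<close>, so it is enough to control the error of each \<open>w\<^sub>i\<close>.

  The error of one step has three sources. The data noise contributes at most
  \<open>2 \<delta> / sqrt a\<^sub>i\<close>: the energy identity \<open>\<langle>(T + a) w, w\<rangle> = \<bar>K w\<bar>\<^sup>2 + a \<bar>w\<bar>\<^sup>2\<close> lets \<open>\<langle>g, K w\<rangle>\<close> be absorbed, and the
  admissible discretization errors use up only half of the coercivity. This is the lemma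
  \<open>perturbed_normal_equation_bound\<close>. The consistency error \<open>T\<^sub>i y - K\<^sub>i\<^sup>* K y\<close> contributes \<open>O(a\<^sub>i)\<close>. The regularization
  bias is the only term without a rate; it is small because \<open>y\<close>, being orthogonal to the nullspace of \<open>K\<close>, lies
  in the closure of the range of \<open>T = K\<^sup>*K\<close> (\<open>orthogonal_nullspace_approx\<close>): if \<open>T v\<close> is within \<open>\<epsilon>\<close> of \<open>y\<close>, the bias is at most
  \<open>2 \<epsilon> + O(a\<^sub>i \<bar>v\<bar>)\<close>. The lemma \<open>regularized_solution_error\<close> combines the three, and \<open>iterate_error\<close> sums them
  to \<open>2 \<delta> / sqrt a\<^sub>n + 2 \<epsilon> + q\<^sup>n (\<bar>y\<bar> + n const)\<close>. Here \<open>const\<close> depends on \<open>v\<close>, hence on \<open>\<epsilon>\<close>, but not on \<open>n\<close> or \<open>\<delta>\<close>, so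
  the limit superior as \<open>\<delta>\<close> tends to 0 is at most \<open>2 \<epsilon>\<close>, for every \<open>\<epsilon>\<close>.

  Both the range closure and the existence of \<open>w\<^sub>i\<close> rest on the completeness of \<open>L\<^sup>2\<close> (\<open>L2_complete\<close>). From it a
  single projection lemma, \<open>range_closure_projection\<close>, is derived; it yields the range closure on the one hand, and
  on the other hand the solvability of coercive equations (\<open>coercive_bounded_op_surj\<close>), without
  which the chosen inverse image in the iteration would be an arbitrary value.\<close>

section \<open>Conjugation and real part\<close>

lemma mult_sconj_of_real: "x * sconj x = of_real ((norm (x::'a::conj_scalar))\<^sup>2)"
  by (simp only: mult_sconj of_real_def)

lemma sconj_0 [simp]: "sconj (0::'a::conj_scalar) = 0"
  using sconj_add[of "0::'a" 0] by simp

lemma sconj_eq_divide: "(x::'a::conj_scalar) \<noteq> 0 \<Longrightarrow> sconj x = of_real ((norm x)\<^sup>2) / x"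
  using mult_sconj_of_real[of x] by (simp add: field_simps)

lemma norm_sconj [simp]: "norm (sconj x) = norm (x::'a::conj_scalar)"
proof (cases "x = 0")
  case False
  have "norm x * norm (sconj x) = (norm x)\<^sup>2"
    using arg_cong[OF mult_sconj_of_real[of x], of norm] by (simp add: norm_mult norm_power)
  then show ?thesis using False by (simp add: power2_eq_square)
qed simp

lemma sconj_mult: "sconj (x * y) = sconj x * sconj (y::'a::conj_scalar)"
  by (cases "x = 0"; cases "y = 0") (simp_all add: sconj_eq_divide norm_mult power_mult_distrib)

lemma sconj_sconj [simp]: "sconj (sconj x) = (x::'a::conj_scalar)"
proof (cases "x = 0")
  case False
  then have "sconj x \<noteq> 0" by (metis norm_eq_zero norm_sconj)
  then show ?thesis using False by (simp add: sconj_eq_divide[of "sconj x"]) (simp add: sconj_eq_divide)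
qed simp

lemma sconj_of_real [simp]: "sconj (of_real r) = (of_real r :: 'a::conj_scalar)"
proof (cases "r = 0")
  case False
  then have "sconj (of_real r :: 'a) = of_real (r\<^sup>2) / of_real r"
    by (simp add: sconj_eq_divide)
  also have "\<dots> = of_real r" using False by (simp add: power2_eq_square)
  finally show ?thesis .
qed simp

text \<open>The conjugation is an isometric real-linear involution, so it commutes with the integral and
  preserves measurability.\<close>

lemma bounded_linear_sconj: "bounded_linear (sconj :: 'a::conj_scalar \<Rightarrow> 'a)"
proof (rule bounded_linear_intro[where K = 1])
  fix x y :: 'a and r :: real
  show "sconj (x + y) = sconj x + sconj y" by (rule sconj_add)
  show "sconj (r *\<^sub>R x) = r *\<^sub>R sconj x" by (simp add: scaleR_conv_of_real sconj_mult)
  show "norm (sconj x) \<le> norm x * 1" by simp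
qed

text \<open>The real part, written with norms only: the class offers no projection onto the reals, but
  \<open>\<bar>1 + s\<bar>\<^sup>2 = 1 + 2 Re s + \<bar>s\<bar>\<^sup>2\<close> determines it.\<close>

definition re_part :: "'a::conj_scalar \<Rightarrow> real" where
  "re_part s = ((norm (1 + s))\<^sup>2 - 1 - (norm s)\<^sup>2) / 2"

text \<open>Expanding \<open>(1 + s) * sconj (1 + s)\<close> shows that \<open>s + sconj s\<close> is a real scalar, although nothing
  in the class says so directly.\<close>

lemma of_real_re_part: "of_real (2 * re_part s) = s + sconj (s::'a::conj_scalar)"
proof -
  have "of_real ((norm (1 + s))\<^sup>2) = (1 + s) * (1 + sconj s)"
    using mult_sconj_of_real[of "1 + s"] sconj_of_real[of 1, where 'a='a] by (simp add: sconj_add)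
  also have "\<dots> = 1 + (s + sconj s) + s * sconj s"
    by (simp add: algebra_simps)
  also have "\<dots> = 1 + (s + sconj s) + of_real ((norm s)\<^sup>2)"
    by (simp only: mult_sconj_of_real)
  finally show ?thesis by (simp add: re_part_def del: of_real_power)
qed

lemma re_part_eqI: "of_real (2 * r) = s + sconj (s::'a::conj_scalar) \<Longrightarrow> re_part s = r"
  using of_real_re_part[of s] by (metis mult_cancel_left of_real_eq_iff zero_neq_numeral)

lemma re_part_sconj [simp]: "re_part (sconj s) = re_part (s::'a::conj_scalar)"
  by (rule re_part_eqI) (simp only: of_real_re_part sconj_sconj add.commute)

lemma re_part_of_real [simp]: "re_part (of_real r :: 'a::conj_scalar) = r"
  by (rule re_part_eqI) simp

lemma bounded_linear_re_part: "bounded_linear (re_part :: 'a::conj_scalar \<Rightarrow> real)"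
proof (rule bounded_linear_intro[where K = 1])
  fix x y :: 'a and r :: real
  show "re_part (x + y) = re_part x + re_part y"
  proof (rule re_part_eqI)
    have "of_real (2 * (re_part x + re_part y)) = of_real (2 * re_part x) + (of_real (2 * re_part y) :: 'a)"
      by (simp add: algebra_simps)
    then show "of_real (2 * (re_part x + re_part y)) = x + y + sconj (x + y)"
      by (simp only: of_real_re_part) (simp add: sconj_add algebra_simps)
  qed
  show "re_part (r *\<^sub>R x) = r *\<^sub>R re_part x"
  proof (rule re_part_eqI)
    have "of_real (2 * (r *\<^sub>R re_part x)) = of_real r * (of_real (2 * re_part x) :: 'a)"
      by simp
    then show "of_real (2 * (r *\<^sub>R re_part x)) = r *\<^sub>R x + sconj (r *\<^sub>R x)"
      by (simp only: of_real_re_part) (simp add: scaleR_conv_of_real sconj_mult algebra_simps)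
  qed
  have "\<bar>2 * re_part x\<bar> = norm (of_real (2 * re_part x) :: 'a)" by (simp only: norm_of_real)
  also have "\<dots> \<le> norm x + norm (sconj x)" by (simp only: of_real_re_part norm_triangle_ineq)
  finally show "norm (re_part x) \<le> norm x * 1" by simp
qed

section \<open>Square-integrable functions as a real inner product space\<close>

lemma L2_square_integrable: "u \<in> L2 M \<Longrightarrow> integrable M (\<lambda>x. (norm (u x))\<^sup>2)"
  by (simp add: L2_def)

lemma L2_zero [simp]: "(\<lambda>x. 0) \<in> L2 M"
  by (simp add: L2_def)

lemma L2_norm: "u \<in> L2 M \<Longrightarrow> (\<lambda>x. norm (u x)) \<in> L2 M"
  by (auto simp: L2_def)

lemma L2_add:
  fixes u v :: "'b \<Rightarrow> 'a::conj_scalar"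
  assumes u: "u \<in> L2 M" and v: "v \<in> L2 M"
  shows "(\<lambda>x. u x + v x) \<in> L2 M"
proof -
  have [measurable]: "u \<in> borel_measurable M" "v \<in> borel_measurable M" using u v by (auto simp: L2_def)
  have "integrable M (\<lambda>x. (norm (u x + v x))\<^sup>2)"
  proof (rule Bochner_Integration.integrable_bound)
    show "integrable M (\<lambda>x. 2 * (norm (u x))\<^sup>2 + 2 * (norm (v x))\<^sup>2)"
      using u v by (auto simp: L2_def)
    show "(\<lambda>x. (norm (u x + v x))\<^sup>2) \<in> borel_measurable M" by measurable
    show "AE x in M. norm ((norm (u x + v x))\<^sup>2) \<le> norm (2 * (norm (u x))\<^sup>2 + 2 * (norm (v x))\<^sup>2)"
    proof (rule AE_I2)
      fix x
      have "(norm (u x + v x))\<^sup>2 \<le> (norm (u x) + norm (v x))\<^sup>2"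
        by (intro power_mono norm_triangle_ineq norm_ge_zero)
      also have "\<dots> \<le> 2 * (norm (u x))\<^sup>2 + 2 * (norm (v x))\<^sup>2"
        using sum_squares_bound[of "norm (u x)" "norm (v x)"] by (simp add: power2_sum)
      finally show "norm ((norm (u x + v x))\<^sup>2) \<le> norm (2 * (norm (u x))\<^sup>2 + 2 * (norm (v x))\<^sup>2)"
        by simp
    qed
  qed
  then show ?thesis by (simp add: L2_def)
qed

lemma L2_scale: "u \<in> L2 M \<Longrightarrow> (\<lambda>x. s * u x) \<in> L2 M"
  by (auto simp: L2_def norm_mult power_mult_distrib)

lemma L2_uminus: "u \<in> L2 M \<Longrightarrow> (\<lambda>x. - u x) \<in> L2 M"
  by (simp add: L2_def)

lemma L2_diff:
  "u \<in> L2 M \<Longrightarrow> v \<in> L2 M \<Longrightarrow> (\<lambda>x. u x - v x) \<in> L2 M"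
  using L2_add[OF _ L2_uminus, of u M v] by simp

lemmas L2_closed = L2_add L2_diff L2_scale L2_uminus L2_norm L2_zero

lemma L2_sum:
  "(\<And>i. i \<in> I \<Longrightarrow> u i \<in> L2 M) \<Longrightarrow> (\<lambda>x. \<Sum>i\<in>I. u i x) \<in> L2 M"
  by (induction I rule: infinite_finite_induct) (auto intro: L2_closed)

lemma integrable_mult_sconj:
  fixes u v :: "'b \<Rightarrow> 'a::conj_scalar"
  assumes u: "u \<in> L2 M" and v: "v \<in> L2 M"
  shows "integrable M (\<lambda>x. u x * sconj (v x))"
proof (rule Bochner_Integration.integrable_bound)
  have [measurable]: "(sconj :: 'a \<Rightarrow> 'a) \<in> borel_measurable borel"
    by (intro borel_measurable_continuous_onI linear_continuous_on bounded_linear_sconj)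
  have [measurable]: "u \<in> borel_measurable M" "v \<in> borel_measurable M" using u v by (auto simp: L2_def)
  show "(\<lambda>x. u x * sconj (v x)) \<in> borel_measurable M" by measurable
  show "integrable M (\<lambda>x. (norm (u x))\<^sup>2 + (norm (v x))\<^sup>2)"
    using u v by (auto simp: L2_def)
  show "AE x in M. norm (u x * sconj (v x)) \<le> norm ((norm (u x))\<^sup>2 + (norm (v x))\<^sup>2)"
  proof (rule AE_I2)
    fix x
    have "0 \<le> norm (u x) * norm (v x)" by simp
    then have "norm (u x) * norm (v x) \<le> (norm (u x))\<^sup>2 + (norm (v x))\<^sup>2"
      using sum_squares_bound[of "norm (u x)" "norm (v x)"] by linarith
    then show "norm (u x * sconj (v x)) \<le> norm ((norm (u x))\<^sup>2 + (norm (v x))\<^sup>2)"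
      by (simp add: norm_mult)
  qed
qed

text \<open>All estimates below need only the real part of the inner product. It is a real bilinear form
  that induces the same norm, which allows the usual real Hilbert space arguments to be carried out
  for both scalar fields at once.\<close>

definition l2_re_inner :: "'b measure \<Rightarrow> ('b \<Rightarrow> 'a::conj_scalar) \<Rightarrow> ('b \<Rightarrow> 'a) \<Rightarrow> real" where
  "l2_re_inner M u v = re_part (l2_inner M u v)"

lemma l2_re_inner_integral:
  assumes "u \<in> L2 M" "v \<in> L2 M"
  shows "l2_re_inner M u v = (LINT x|M. re_part (u x * sconj (v x)))"
  unfolding l2_re_inner_def l2_inner_def
  by (rule integral_bounded_linear[OF bounded_linear_re_part integrable_mult_sconj[OF assms], symmetric])

lemma l2_re_inner_commute:
  assumes "u \<in> L2 M" "v \<in> L2 M"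
  shows "l2_re_inner M u v = l2_re_inner M v u"
proof -
  have "re_part (u x * sconj (v x)) = re_part (v x * sconj (u x))" for x
    using re_part_sconj[of "u x * sconj (v x)"] by (simp add: sconj_mult mult.commute)
  then show ?thesis using assms by (simp add: l2_re_inner_integral)
qed

lemma l2_re_inner_add_left:
  assumes "u \<in> L2 M" "v \<in> L2 M" "w \<in> L2 M"
  shows "l2_re_inner M (\<lambda>x. u x + v x) w = l2_re_inner M u w + l2_re_inner M v w"
  using assms
  by (simp add: l2_re_inner_def l2_inner_def distrib_right integrable_mult_sconj
      linear_add[OF bounded_linear.linear[OF bounded_linear_re_part]])

lemma l2_re_inner_scale_left:
  "l2_re_inner M (\<lambda>x. of_real r * u x) w = r * l2_re_inner M u w"
  using linear_cmul[OF bounded_linear.linear[OF bounded_linear_re_part], of r "l2_inner M u w"]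
  by (simp add: l2_re_inner_def l2_inner_def mult.assoc scaleR_conv_of_real)

lemma l2_re_inner_add_right:
  assumes "u \<in> L2 M" "v \<in> L2 M" "w \<in> L2 M"
  shows "l2_re_inner M w (\<lambda>x. u x + v x) = l2_re_inner M w u + l2_re_inner M w v"
  using assms l2_re_inner_add_left[OF assms] by (simp add: l2_re_inner_commute[of w] L2_closed)

lemma l2_re_inner_scale_right:
  assumes "u \<in> L2 M" "w \<in> L2 M"
  shows "l2_re_inner M w (\<lambda>x. of_real r * u x) = r * l2_re_inner M w u"
  using assms by (simp add: l2_re_inner_commute[of w] L2_closed l2_re_inner_scale_left)

lemma l2_re_inner_zero_left [simp]: "l2_re_inner M (\<lambda>x. 0) w = 0"
  using l2_re_inner_scale_left[of M 0 "\<lambda>x. 0" w] by simp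

lemma l2_re_inner_diff_left:
  assumes "u \<in> L2 M" "v \<in> L2 M" "w \<in> L2 M"
  shows "l2_re_inner M (\<lambda>x. u x - v x) w = l2_re_inner M u w - l2_re_inner M v w"
  using l2_re_inner_add_left[of "\<lambda>x. u x - v x" M v w] assms by (simp add: L2_closed)

lemma l2_norm_nonneg [simp]: "0 \<le> l2_norm M u"
  by (simp add: l2_norm_def)

lemma l2_norm_zero [simp]: "l2_norm M (\<lambda>x. 0) = 0"
  by (simp add: l2_norm_def)

lemma l2_norm_power2: "(l2_norm M u)\<^sup>2 = (LINT x|M. (norm (u x))\<^sup>2)"
  by (simp add: l2_norm_def)

lemma l2_re_inner_self: "u \<in> L2 M \<Longrightarrow> l2_re_inner M u u = (l2_norm M u)\<^sup>2"
  by (simp add: l2_re_inner_integral l2_norm_power2 mult_sconj_of_real del: of_real_power)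

lemma l2_norm_norm [simp]: "l2_norm M (\<lambda>x. norm (u x)) = l2_norm M u"
  by (simp add: l2_norm_def)

lemma l2_norm_scale: "l2_norm M (\<lambda>x. s * u x) = norm s * l2_norm M u"
  by (simp add: l2_norm_def norm_mult power_mult_distrib real_sqrt_mult)

lemma l2_norm_uminus [simp]: "l2_norm M (\<lambda>x. - u x) = l2_norm M u"
  by (simp add: l2_norm_def)

lemma l2_norm_diff_commute: "l2_norm M (\<lambda>x. u x - v x) = l2_norm M (\<lambda>x. v x - u x)"
  by (simp add: l2_norm_def norm_minus_commute)

text \<open>The restriction of the squared norm to a line is a quadratic polynomial. Cauchy-Schwarz, the
  triangle inequality and the variational arguments for the projection all follow from this expansion.\<close>

lemma l2_norm_add_scale_power2:
  assumes u: "u \<in> L2 M" and v: "v \<in> L2 M"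
  shows "(l2_norm M (\<lambda>x. u x + of_real r * v x))\<^sup>2 =
    (l2_norm M u)\<^sup>2 + 2 * r * l2_re_inner M u v + r\<^sup>2 * (l2_norm M v)\<^sup>2"
proof -
  have rv: "(\<lambda>x. of_real r * v x) \<in> L2 M" using v by (rule L2_scale)
  have "(l2_norm M (\<lambda>x. u x + of_real r * v x))\<^sup>2 =
     l2_re_inner M (\<lambda>x. u x + of_real r * v x) (\<lambda>x. u x + of_real r * v x)"
    by (simp add: l2_re_inner_self L2_add u rv)
  also have "\<dots> = l2_re_inner M u u + r * l2_re_inner M u v + (r * l2_re_inner M v u + r * (r * l2_re_inner M v v))"
    by (simp add: l2_re_inner_add_left l2_re_inner_add_right u v rv L2_add
        l2_re_inner_scale_left l2_re_inner_scale_right distrib_left)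
  finally show ?thesis
    using l2_re_inner_commute[OF v u] by (simp add: l2_re_inner_self u v power2_eq_square)
qed

lemma l2_Cauchy_Schwarz:
  assumes u: "u \<in> L2 M" and v: "v \<in> L2 M"
  shows "l2_re_inner M u v \<le> l2_norm M u * l2_norm M v"
proof -
  define p where "p = l2_re_inner M u v"
  have pos: "0 \<le> (l2_norm M u)\<^sup>2 + 2 * r * p + r\<^sup>2 * (l2_norm M v)\<^sup>2" for r
    using l2_norm_add_scale_power2[OF u v, of r] unfolding p_def by (metis zero_le_power2)
  have "p\<^sup>2 \<le> (l2_norm M u)\<^sup>2 * (l2_norm M v)\<^sup>2"
  proof (cases "l2_norm M v = 0")
    case True
    have "p = 0"
    proof (rule ccontr)
      assume "p \<noteq> 0"
      then show False using pos[of "- ((l2_norm M u)\<^sup>2 + 1) / (2 * p)"] True by (simp add: field_simps)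
    qed
    then show ?thesis by simp
  next
    case False
    then have nv: "0 < (l2_norm M v)\<^sup>2" by simp
    have "2 * (- p / V) * p + (- p / V)\<^sup>2 * V = - (p\<^sup>2 / V)" if "V > 0" for V :: real
      using that by (simp add: field_simps power2_eq_square)
    from this[OF nv] have "0 \<le> (l2_norm M u)\<^sup>2 - p\<^sup>2 / (l2_norm M v)\<^sup>2"
      using pos[of "- p / (l2_norm M v)\<^sup>2"] by linarith
    then show ?thesis using nv by (simp add: field_simps)
  qed
  then have "p\<^sup>2 \<le> (l2_norm M u * l2_norm M v)\<^sup>2" by (simp add: power_mult_distrib)
  then show ?thesis unfolding p_def[symmetric] by (rule power2_le_imp_le) simp
qed

lemma l2_Cauchy_Schwarz_abs:
  assumes u: "u \<in> L2 M" and v: "v \<in> L2 M"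
  shows "\<bar>l2_re_inner M u v\<bar> \<le> l2_norm M u * l2_norm M v"
  using l2_Cauchy_Schwarz[OF u v] l2_Cauchy_Schwarz[OF L2_uminus[OF u] v]
    l2_re_inner_diff_left[OF L2_zero u v] by simp

lemma l2_norm_triangle:
  assumes u: "u \<in> L2 M" and v: "v \<in> L2 M"
  shows "l2_norm M (\<lambda>x. u x + v x) \<le> l2_norm M u + l2_norm M v"
proof (rule power2_le_imp_le)
  show "(l2_norm M (\<lambda>x. u x + v x))\<^sup>2 \<le> (l2_norm M u + l2_norm M v)\<^sup>2"
    using l2_norm_add_scale_power2[OF u v, of 1] l2_Cauchy_Schwarz[OF u v] by (simp add: power2_sum)
qed simp

lemma l2_norm_triangle_diff:
  assumes u: "u \<in> L2 M" and v: "v \<in> L2 M"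
  shows "l2_norm M (\<lambda>x. u x - v x) \<le> l2_norm M u + l2_norm M v"
  using l2_norm_triangle[OF u L2_uminus[OF v]] by simp

lemma l2_norm_diff_triangle:
  assumes "u \<in> L2 M" "v \<in> L2 M" "w \<in> L2 M"
  shows "l2_norm M (\<lambda>x. u x - w x) \<le> l2_norm M (\<lambda>x. u x - v x) + l2_norm M (\<lambda>x. v x - w x)"
  using l2_norm_triangle[of "\<lambda>x. u x - v x" M "\<lambda>x. v x - w x"] assms by (simp add: L2_closed)

lemma l2_norm_sum_le:
  "(\<And>i. i \<in> I \<Longrightarrow> u i \<in> L2 M) \<Longrightarrow> l2_norm M (\<lambda>x. \<Sum>i\<in>I. u i x) \<le> (\<Sum>i\<in>I. l2_norm M (u i))"
proof (induction I rule: infinite_finite_induct)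
  case (insert i I)
  then show ?case
    using l2_norm_triangle[of "u i" M "\<lambda>x. \<Sum>i\<in>I. u i x"] by (fastforce simp: L2_sum)
qed auto

lemma l2_norm_cong:
  assumes "l2_eq M u v" "u \<in> L2 M" "v \<in> L2 M"
  shows "l2_norm M u = l2_norm M v"
proof -
  have "(LINT x|M. (norm (u x))\<^sup>2) = (LINT x|M. (norm (v x))\<^sup>2)"
  proof (rule integral_cong_AE)
    show "AE x in M. (norm (u x))\<^sup>2 = (norm (v x))\<^sup>2"
      using assms(1) unfolding l2_eq_def by eventually_elim simp
  qed (use assms in \<open>auto simp: L2_def\<close>)
  then show ?thesis by (simp add: l2_norm_def)
qed

lemma l2_norm_eq_0_iff:
  assumes "u \<in> L2 M"
  shows "l2_norm M u = 0 \<longleftrightarrow> l2_eq M u (\<lambda>x. 0)"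
  using integral_nonneg_eq_0_iff_AE[OF L2_square_integrable[OF assms]]
  by (simp add: l2_norm_def l2_eq_def)

lemma l2_eq_iff_l2_norm_diff:
  assumes "u \<in> L2 M" "v \<in> L2 M"
  shows "l2_eq M u v \<longleftrightarrow> l2_norm M (\<lambda>x. u x - v x) = 0"
  using assms by (subst l2_norm_eq_0_iff) (auto simp: L2_closed l2_eq_def)

lemma l2_re_inner_cong:
  assumes "l2_eq M u v" "u \<in> L2 M" "v \<in> L2 M" "w \<in> L2 M"
  shows "l2_re_inner M u w = l2_re_inner M v w"
proof -
  have "l2_inner M u w = l2_inner M v w"
    unfolding l2_inner_def
  proof (rule integral_cong_AE)
    show "AE x in M. u x * sconj (w x) = v x * sconj (w x)"
      using assms(1) unfolding l2_eq_def by eventually_elim simp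
  qed (use assms in \<open>auto intro!: borel_measurable_integrable integrable_mult_sconj\<close>)
  then show ?thesis by (simp add: l2_re_inner_def)
qed

section \<open>Completeness\<close>

lemma l2_re_inner_tendsto:
  assumes x: "\<And>j. x j \<in> L2 M" and u: "u \<in> L2 M" and w: "w \<in> L2 M"
    and lim: "(\<lambda>j::nat. l2_norm M (\<lambda>t. x j t - u t)) \<longlonglongrightarrow> 0"
  shows "(\<lambda>j. l2_re_inner M (x j) w) \<longlonglongrightarrow> l2_re_inner M u w"
proof (rule Lim_transform2)
  show "(\<lambda>j. l2_re_inner M u w) \<longlonglongrightarrow> l2_re_inner M u w" by simp
  show "(\<lambda>j. l2_re_inner M u w - l2_re_inner M (x j) w) \<longlonglongrightarrow> 0"
  proof (rule Lim_null_comparison)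
    show "\<forall>\<^sub>F j in sequentially. norm (l2_re_inner M u w - l2_re_inner M (x j) w)
        \<le> l2_norm M (\<lambda>t. x j t - u t) * l2_norm M w"
      using l2_Cauchy_Schwarz_abs[OF L2_diff[OF x u] w]
      by (intro always_eventually allI) (simp add: l2_re_inner_diff_left x u w abs_minus_commute)
    show "(\<lambda>j. l2_norm M (\<lambda>t. x j t - u t) * l2_norm M w) \<longlonglongrightarrow> 0"
      using tendsto_mult_right[OF lim, of "l2_norm M w"] by simp
  qed
qed

lemma nn_integral_L2:
  assumes "u \<in> L2 M"
  shows "(\<integral>\<^sup>+x. ennreal ((norm (u x))\<^sup>2) \<partial>M) = ennreal ((l2_norm M u)\<^sup>2)"
  using assms by (simp add: l2_norm_power2 nn_integral_eq_integral L2_square_integrable)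

text \<open>Membership and norm bound at once, for limits whose square-integrability is not known in
  advance; the non-negative integral is what Fatou's lemma and monotone convergence control.\<close>

lemma L2_if_nn_integral_le:
  fixes u :: "'b \<Rightarrow> 'a::conj_scalar"
  assumes u [measurable]: "u \<in> borel_measurable M" and c: "0 \<le> c"
    and le: "(\<integral>\<^sup>+x. ennreal ((norm (u x))\<^sup>2) \<partial>M) \<le> ennreal (c\<^sup>2)"
  shows "u \<in> L2 M" "l2_norm M u \<le> c"
proof -
  have "integrable M (\<lambda>x. (norm (u x))\<^sup>2)"
  proof (rule integrableI_nonneg)
    show "(\<integral>\<^sup>+x. ennreal ((norm (u x))\<^sup>2) \<partial>M) < \<infinity>"
      using le by (auto intro: le_less_trans)
  qed auto
  then show L2: "u \<in> L2 M" by (simp add: L2_def)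
  show "l2_norm M u \<le> c"
    using le c unfolding nn_integral_L2[OF L2] by (auto intro: power2_le_imp_le)
qed

text \<open>Riesz-Fischer, for sequences with summable increments. By Minkowski the sums
  \<open>G n = (\<Sum>j<n. norm (x (Suc j) - x j))\<close> are bounded in norm by the total variation, so by monotone
  convergence their limit is finite almost everywhere and \<open>x\<close> converges pointwise there. Fatou's
  lemma then bounds the distance to the pointwise limit by the tail \<open>\<tau>\<close> of the series.

  Every application produces geometrically decaying increments, which is why the hypothesis is
  summability instead of the Cauchy property.\<close>

lemma L2_complete:
  fixes x :: "nat \<Rightarrow> 'b \<Rightarrow> 'a::conj_scalar"
  assumes x: "\<And>j. x j \<in> L2 M"
    and sm: "summable (\<lambda>j. l2_norm M (\<lambda>t. x (Suc j) t - x j t))"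
  shows "\<exists>u\<in>L2 M. (\<lambda>j. l2_norm M (\<lambda>t. x j t - u t)) \<longlonglongrightarrow> 0"
proof -
  have [measurable]: "x j \<in> borel_measurable M" for j using x by (simp add: L2_def)
  define s where "s j = l2_norm M (\<lambda>t. x (Suc j) t - x j t)" for j
  define \<tau> where "\<tau> j = suminf s - (\<Sum>k<j. s k)" for j
  have s: "summable s" "\<And>j. 0 \<le> s j" using sm by (auto simp: s_def[abs_def])
  have \<tau>_nonneg: "0 \<le> \<tau> j" for j
    using sum_le_suminf[OF s(1), of "{..<j}"] s(2) by (simp add: \<tau>_def)
  have \<tau>_lim: "\<tau> \<longlonglongrightarrow> 0"
    unfolding \<tau>_def[abs_def] using tendsto_diff[OF tendsto_const summable_LIMSEQ[OF s(1)], of "suminf s"] by simp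
  have tail: "l2_norm M (\<lambda>t. x i t - x j t) \<le> \<tau> j" if "j \<le> i" for i j
  proof -
    have "l2_norm M (\<lambda>t. x i t - x j t) \<le> (\<Sum>k<i. s k) - (\<Sum>k<j. s k)"
      using that
    proof (induction i rule: dec_induct)
      case (step i)
      have "l2_norm M (\<lambda>t. x (Suc i) t - x j t) \<le> s i + l2_norm M (\<lambda>t. x i t - x j t)"
        unfolding s_def by (rule l2_norm_diff_triangle) (rule x)+
      then show ?case using step.IH by simp
    qed simp
    also have "\<dots> \<le> \<tau> j"
      using sum_le_suminf[OF s(1), of "{..<i}"] s(2) by (simp add: \<tau>_def)
    finally show ?thesis .
  qed
  define G where "G n t = (\<Sum>j<n. norm (x (Suc j) t - x j t))" for n t
  have [measurable]: "G n \<in> borel_measurable M" for n unfolding G_def[abs_def] by measurable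
  have G_L2: "G n \<in> L2 M" for n
    unfolding G_def[abs_def] by (intro L2_sum L2_norm L2_diff x)
  have G_norm: "l2_norm M (G n) \<le> suminf s" for n
  proof -
    have "l2_norm M (G n) \<le> (\<Sum>j<n. l2_norm M (\<lambda>t. norm (x (Suc j) t - x j t)))"
      unfolding G_def[abs_def] by (intro l2_norm_sum_le L2_norm L2_diff x)
    also have "\<dots> = (\<Sum>j<n. s j)" by (simp add: s_def)
    also have "\<dots> \<le> suminf s" using sum_le_suminf[OF s(1), of "{..<n}"] s(2) by simp
    finally show ?thesis .
  qed
  have G_nonneg: "0 \<le> G n t" for n t by (simp add: G_def sum_nonneg)
  have G_mono: "G i t \<le> G j t" if "i \<le> j" for i j t
    unfolding G_def using that by (intro sum_mono2) auto
  have "(\<integral>\<^sup>+t. (SUP n. ennreal ((G n t)\<^sup>2)) \<partial>M) = (SUP n. \<integral>\<^sup>+t. ennreal ((G n t)\<^sup>2) \<partial>M)"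
    by (intro nn_integral_monotone_convergence_SUP incseq_SucI le_funI ennreal_leI power_mono G_mono G_nonneg)
       auto
  also have "\<dots> \<le> ennreal ((suminf s)\<^sup>2)"
  proof (rule SUP_least)
    fix n
    have "(\<integral>\<^sup>+t. ennreal ((G n t)\<^sup>2) \<partial>M) = ennreal ((l2_norm M (G n))\<^sup>2)"
      using nn_integral_L2[OF G_L2[of n]] by simp
    also have "\<dots> \<le> ennreal ((suminf s)\<^sup>2)"
      by (intro ennreal_leI power_mono G_norm) simp
    finally show "(\<integral>\<^sup>+t. ennreal ((G n t)\<^sup>2) \<partial>M) \<le> ennreal ((suminf s)\<^sup>2)" .
  qed
  finally have "(\<integral>\<^sup>+t. (SUP n. ennreal ((G n t)\<^sup>2)) \<partial>M) \<noteq> \<infinity>"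
    by (auto simp: top_unique)
  then have "AE t in M. (SUP n. ennreal ((G n t)\<^sup>2)) \<noteq> \<infinity>"
    by (intro nn_integral_PInf_AE) auto
  then have conv: "AE t in M. (\<lambda>j. x j t) \<longlonglongrightarrow> lim (\<lambda>j. x j t)"
  proof eventually_elim
    case (elim t)
    then obtain B where B: "0 \<le> B" "(SUP n. ennreal ((G n t)\<^sup>2)) = ennreal B"
      by (cases "SUP n. ennreal ((G n t)\<^sup>2)") auto
    have bound: "G n t \<le> sqrt B" for n
    proof -
      have "ennreal ((G n t)\<^sup>2) \<le> ennreal B" unfolding B(2)[symmetric] by (rule SUP_upper) simp
      then have "(G n t)\<^sup>2 \<le> B" using B(1) by (simp add: ennreal_le_iff)
      then show ?thesis by (rule real_le_rsqrt)
    qed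
    have "summable (\<lambda>j. norm (x (Suc j) t - x j t))"
      by (rule bounded_imp_summable[where B = "sqrt B"])
         (use bound in \<open>simp_all only: G_def norm_ge_zero lessThan_Suc_atMost[symmetric]\<close>)
    then have "summable (\<lambda>j. x (Suc j) t - x j t)" by (rule summable_norm_cancel)
    then have "convergent (\<lambda>n. \<Sum>j<n. x (Suc j) t - x j t)" by (simp add: summable_iff_convergent)
    then have "convergent (\<lambda>n. x n t - x 0 t)" by (simp only: sum_lessThan_telescope[of "\<lambda>j. x j t"])
    then have "convergent (\<lambda>n. x n t)" by (simp add: convergent_diff_const_right_iff)
    then show ?case by (simp add: convergent_LIMSEQ_iff)
  qed
  define u where "u t = lim (\<lambda>j. x j t)" for t
  have [measurable]: "u \<in> borel_measurable M" unfolding u_def[abs_def] by measurable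
  have diff: "(\<lambda>t. u t - x j t) \<in> L2 M" "l2_norm M (\<lambda>t. u t - x j t) \<le> \<tau> j" for j
  proof -
    have "(\<integral>\<^sup>+t. ennreal ((norm (u t - x j t))\<^sup>2) \<partial>M)
        = (\<integral>\<^sup>+t. liminf (\<lambda>i. ennreal ((norm (x i t - x j t))\<^sup>2)) \<partial>M)"
    proof (rule nn_integral_cong_AE)
      show "AE t in M. ennreal ((norm (u t - x j t))\<^sup>2) = liminf (\<lambda>i. ennreal ((norm (x i t - x j t))\<^sup>2))"
        using conv
      proof eventually_elim
        case (elim t)
        then have "(\<lambda>i. ennreal ((norm (x i t - x j t))\<^sup>2)) \<longlonglongrightarrow> ennreal ((norm (u t - x j t))\<^sup>2)"
          unfolding u_def by (intro tendsto_intros)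
        then show ?case by (intro lim_imp_Liminf[symmetric] trivial_limit_sequentially)
      qed
    qed
    also have "\<dots> \<le> liminf (\<lambda>i. \<integral>\<^sup>+t. ennreal ((norm (x i t - x j t))\<^sup>2) \<partial>M)"
      by (rule nn_integral_liminf) measurable
    also have "\<dots> \<le> ennreal ((\<tau> j)\<^sup>2)"
    proof (rule Liminf_le)
      show "\<forall>\<^sub>F i in sequentially. (\<integral>\<^sup>+t. ennreal ((norm (x i t - x j t))\<^sup>2) \<partial>M) \<le> ennreal ((\<tau> j)\<^sup>2)"
        using eventually_ge_at_top[of j]
      proof eventually_elim
        case (elim i)
        then show ?case
          by (simp add: nn_integral_L2[OF L2_diff[OF x x]] ennreal_leI power_mono tail)
      qed
    qed simp
    finally show "(\<lambda>t. u t - x j t) \<in> L2 M" "l2_norm M (\<lambda>t. u t - x j t) \<le> \<tau> j"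
      using L2_if_nn_integral_le[of "\<lambda>t. u t - x j t" M "\<tau> j"] \<tau>_nonneg by auto
  qed
  have "u \<in> L2 M" using L2_add[OF diff(1)[of 0] x[of 0]] by simp
  moreover have "(\<lambda>j. l2_norm M (\<lambda>t. x j t - u t)) \<longlonglongrightarrow> 0"
    by (rule tendsto_sandwich[OF _ _ tendsto_const \<tau>_lim])
       (use diff(2) in \<open>auto simp: l2_norm_diff_commute[of M _ u]\<close>)
  ultimately show ?thesis by blast
qed

section \<open>Bounded operators\<close>

lemma bounded_op_L2: "bounded_op M A \<Longrightarrow> u \<in> L2 M \<Longrightarrow> A u \<in> L2 M"
  by (simp add: bounded_op_def)

lemma bounded_op_add:
  "bounded_op M A \<Longrightarrow> u \<in> L2 M \<Longrightarrow> v \<in> L2 M \<Longrightarrow> l2_eq M (A (\<lambda>x. u x + v x)) (\<lambda>x. A u x + A v x)"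
  by (simp add: bounded_op_def)

lemma bounded_op_scale:
  "bounded_op M A \<Longrightarrow> u \<in> L2 M \<Longrightarrow> l2_eq M (A (\<lambda>x. s * u x)) (\<lambda>x. s * A u x)"
  by (simp add: bounded_op_def)

lemma bounded_opI:
  fixes A :: "('b \<Rightarrow> 'a::conj_scalar) \<Rightarrow> ('b \<Rightarrow> 'a)"
  assumes "\<And>u. u \<in> L2 M \<Longrightarrow> A u \<in> L2 M"
    and "\<And>u v. u \<in> L2 M \<Longrightarrow> v \<in> L2 M \<Longrightarrow> l2_eq M (A (\<lambda>x. u x + v x)) (\<lambda>x. A u x + A v x)"
    and "\<And>s u. u \<in> L2 M \<Longrightarrow> l2_eq M (A (\<lambda>x. s * u x)) (\<lambda>x. s * A u x)"
    and "\<And>u. u \<in> L2 M \<Longrightarrow> l2_norm M (A u) \<le> C * l2_norm M u"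
  shows "bounded_op M A"
  unfolding bounded_op_def using assms by blast

lemma bounded_op_bound:
  fixes A :: "('b \<Rightarrow> 'a::conj_scalar) \<Rightarrow> ('b \<Rightarrow> 'a)"
  assumes "bounded_op M A"
  obtains C where "0 \<le> C" "\<And>u. u \<in> L2 M \<Longrightarrow> l2_norm M (A u) \<le> C * l2_norm M u"
proof -
  obtain C where C: "\<And>u. u \<in> L2 M \<Longrightarrow> l2_norm M (A u) \<le> C * l2_norm M u"
    using assms unfolding bounded_op_def by blast
  show ?thesis
  proof (rule that[of "max C 0"])
    fix u :: "'b \<Rightarrow> 'a" assume "u \<in> L2 M"
    then show "l2_norm M (A u) \<le> max C 0 * l2_norm M u"
      using C[of u] mult_right_mono[of C "max C 0" "l2_norm M u"] by simp
  qed simp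
qed

lemma bounded_op_diff:
  assumes A: "bounded_op M A" and u: "u \<in> L2 M" and v: "v \<in> L2 M"
  shows "l2_eq M (A (\<lambda>x. u x - v x)) (\<lambda>x. A u x - A v x)"
proof -
  have "l2_eq M (A (\<lambda>x. u x + (- 1) * v x)) (\<lambda>x. A u x + A (\<lambda>x. (- 1) * v x) x)"
    by (rule bounded_op_add[OF A u L2_scale[OF v]])
  moreover have "l2_eq M (A (\<lambda>x. (- 1) * v x)) (\<lambda>x. (- 1) * A v x)"
    by (rule bounded_op_scale[OF A v])
  ultimately show ?thesis
    unfolding l2_eq_def by eventually_elim simp
qed

text \<open>An almost-everywhere linear bounded operator maps a function of norm zero to a function of norm
  zero, hence it acts on the classes. This is what makes compositions of such operators linear.\<close>

lemma bounded_op_cong: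
  assumes A: "bounded_op M A" and uv: "l2_eq M u v" and u: "u \<in> L2 M" and v: "v \<in> L2 M"
  shows "l2_eq M (A u) (A v)"
proof -
  obtain C where C: "l2_norm M (A (\<lambda>x. u x - v x)) \<le> C * l2_norm M (\<lambda>x. u x - v x)"
    using bounded_op_bound[OF A] L2_diff[OF u v] by metis
  then have "l2_norm M (A (\<lambda>x. u x - v x)) = 0"
    using uv l2_norm_nonneg[of M "A (\<lambda>x. u x - v x)"]
    by (simp add: l2_eq_iff_l2_norm_diff u v del: l2_norm_nonneg)
  then have "l2_eq M (A (\<lambda>x. u x - v x)) (\<lambda>x. 0)"
    by (simp add: l2_norm_eq_0_iff bounded_op_L2[OF A] L2_diff u v)
  with bounded_op_diff[OF A u v] show ?thesis
    unfolding l2_eq_def by eventually_elim simp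
qed

lemma l2_norm_bounded_op_diff:
  assumes A: "bounded_op M A" and u: "u \<in> L2 M" and v: "v \<in> L2 M"
  shows "l2_norm M (\<lambda>x. A u x - A v x) = l2_norm M (A (\<lambda>x. u x - v x))"
  by (rule l2_norm_cong[OF bounded_op_diff[OF A u v], symmetric])
     (intro bounded_op_L2[OF A] L2_diff u v)+

lemma bounded_op_comp:
  assumes A: "bounded_op M A" and B: "bounded_op M B"
  shows "bounded_op M (A \<circ> B)"
proof -
  obtain C where C: "0 \<le> C" "\<And>u. u \<in> L2 M \<Longrightarrow> l2_norm M (A u) \<le> C * l2_norm M u"
    using bounded_op_bound[OF A] by blast
  obtain E where E: "0 \<le> E" "\<And>u. u \<in> L2 M \<Longrightarrow> l2_norm M (B u) \<le> E * l2_norm M u"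
    using bounded_op_bound[OF B] by blast
  note L2 = bounded_op_L2[OF A] bounded_op_L2[OF B] L2_closed
  have "l2_eq M ((A \<circ> B) (\<lambda>x. u x + v x)) (\<lambda>x. (A \<circ> B) u x + (A \<circ> B) v x)"
    if "u \<in> L2 M" "v \<in> L2 M" for u v
  proof -
    have "l2_eq M (A (B (\<lambda>x. u x + v x))) (A (\<lambda>x. B u x + B v x))"
      by (rule bounded_op_cong[OF A bounded_op_add[OF B that]]) (intro L2 that)+
    moreover have "l2_eq M (A (\<lambda>x. B u x + B v x)) (\<lambda>x. A (B u) x + A (B v) x)"
      by (rule bounded_op_add[OF A]) (intro L2 that)+
    ultimately show ?thesis unfolding l2_eq_def o_def by eventually_elim simp
  qed
  moreover have "l2_eq M ((A \<circ> B) (\<lambda>x. s * u x)) (\<lambda>x. s * (A \<circ> B) u x)" if "u \<in> L2 M" for s u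
  proof -
    have "l2_eq M (A (B (\<lambda>x. s * u x))) (A (\<lambda>x. s * B u x))"
      by (rule bounded_op_cong[OF A bounded_op_scale[OF B that]]) (intro L2 that)+
    moreover have "l2_eq M (A (\<lambda>x. s * B u x)) (\<lambda>x. s * A (B u) x)"
      by (rule bounded_op_scale[OF A]) (intro L2 that)+
    ultimately show ?thesis unfolding l2_eq_def o_def by eventually_elim simp
  qed
  moreover have "l2_norm M ((A \<circ> B) u) \<le> (C * E) * l2_norm M u" if "u \<in> L2 M" for u
    using C(2)[OF L2(2)[OF that]] mult_left_mono[OF E(2)[OF that] C(1)] by (simp add: mult.assoc)
  ultimately show ?thesis
    by (intro bounded_opI[where C = "C * E"]) (auto intro: L2)
qed

lemma bounded_op_op_diff:
  assumes A: "bounded_op M A" and B: "bounded_op M B"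
  shows "bounded_op M (op_diff A B)"
proof -
  obtain C where C: "0 \<le> C" "\<And>u. u \<in> L2 M \<Longrightarrow> l2_norm M (A u) \<le> C * l2_norm M u"
    using bounded_op_bound[OF A] by blast
  obtain E where E: "0 \<le> E" "\<And>u. u \<in> L2 M \<Longrightarrow> l2_norm M (B u) \<le> E * l2_norm M u"
    using bounded_op_bound[OF B] by blast
  note L2 = bounded_op_L2[OF A] bounded_op_L2[OF B] L2_closed
  have "l2_eq M (op_diff A B (\<lambda>x. u x + v x)) (\<lambda>x. op_diff A B u x + op_diff A B v x)"
    if "u \<in> L2 M" "v \<in> L2 M" for u v
    using bounded_op_add[OF A that] bounded_op_add[OF B that]
    unfolding l2_eq_def op_diff_def by eventually_elim simp
  moreover have "l2_eq M (op_diff A B (\<lambda>x. s * u x)) (\<lambda>x. s * op_diff A B u x)" if "u \<in> L2 M" for s u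
    using bounded_op_scale[OF A that, of s] bounded_op_scale[OF B that, of s]
    unfolding l2_eq_def op_diff_def by eventually_elim (simp add: right_diff_distrib)
  moreover have "l2_norm M (op_diff A B u) \<le> (C + E) * l2_norm M u" if "u \<in> L2 M" for u
    using l2_norm_triangle_diff[OF L2(1)[OF that] L2(2)[OF that]] C(2)[OF that] E(2)[OF that]
    by (simp add: op_diff_def distrib_right)
  ultimately show ?thesis
    by (intro bounded_opI[where C = "C + E"]) (auto simp: op_diff_def intro: L2)
qed

lemma bounded_op_op_shift:
  assumes A: "bounded_op M A"
  shows "bounded_op M (op_shift A r)"
proof -
  obtain C where C: "0 \<le> C" "\<And>u. u \<in> L2 M \<Longrightarrow> l2_norm M (A u) \<le> C * l2_norm M u"
    using bounded_op_bound[OF A] by blast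
  note L2 = bounded_op_L2[OF A] L2_closed
  have "l2_eq M (op_shift A r (\<lambda>x. u x + v x)) (\<lambda>x. op_shift A r u x + op_shift A r v x)"
    if "u \<in> L2 M" "v \<in> L2 M" for u v
    using bounded_op_add[OF A that]
    unfolding l2_eq_def op_shift_def by eventually_elim (simp add: distrib_left)
  moreover have "l2_eq M (op_shift A r (\<lambda>x. s * u x)) (\<lambda>x. s * op_shift A r u x)" if "u \<in> L2 M" for s u
    using bounded_op_scale[OF A that, of s]
    unfolding l2_eq_def op_shift_def by eventually_elim (simp add: distrib_left mult.left_commute)
  moreover have "l2_norm M (op_shift A r u) \<le> (C + \<bar>r\<bar>) * l2_norm M u" if "u \<in> L2 M" for u
    using l2_norm_triangle[OF L2(1)[OF that] L2_scale[OF that], of "of_real r"] C(2)[OF that]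
    by (simp add: op_shift_def distrib_right l2_norm_scale)
  ultimately show ?thesis
    by (intro bounded_opI[where C = "C + \<bar>r\<bar>"]) (auto simp: op_shift_def intro: L2)
qed

lemma l2_norm_le_op_norm:
  fixes A :: "('b \<Rightarrow> 'a::conj_scalar) \<Rightarrow> ('b \<Rightarrow> 'a)"
  assumes A: "bounded_op M A" and u: "u \<in> L2 M"
  shows "l2_norm M (A u) \<le> op_norm M A * l2_norm M u"
proof -
  obtain C where C: "0 \<le> C" "\<And>u. u \<in> L2 M \<Longrightarrow> l2_norm M (A u) \<le> C * l2_norm M u"
    using bounded_op_bound[OF A] by blast
  show ?thesis
  proof (cases "l2_norm M u = 0")
    case True
    then show ?thesis using C(2)[OF u] by simp
  next
    case False
    define t where "t = 1 / l2_norm M u"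
    define v where "v = (\<lambda>x. of_real t * u x)"
    have v: "v \<in> L2 M" "l2_norm M v = 1"
      unfolding v_def using u False by (simp_all only: L2_scale l2_norm_scale norm_of_real) (simp add: t_def)
    have "l2_norm M (A v) \<le> op_norm M A"
      unfolding op_norm_def
    proof (rule cSUP_upper)
      show "bdd_above ((\<lambda>u. l2_norm M (A u)) ` {u \<in> L2 M. l2_norm M u \<le> 1})"
      proof (rule bdd_aboveI2)
        fix w :: "'b \<Rightarrow> 'a" assume "w \<in> {u \<in> L2 M. l2_norm M u \<le> 1}"
        then show "l2_norm M (A w) \<le> C" using C(2)[of w] mult_left_mono[of "l2_norm M w" 1 C] C(1) by auto
      qed
    qed (use v in simp)
    moreover have "l2_norm M (A v) = l2_norm M (\<lambda>x. of_real t * A u x)"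
      unfolding v_def by (rule l2_norm_cong[OF bounded_op_scale[OF A u]]) (intro bounded_op_L2[OF A] L2_scale u)+
    ultimately have "\<bar>t\<bar> * l2_norm M (A u) \<le> op_norm M A" by (simp only: l2_norm_scale norm_of_real)
    moreover have "0 < l2_norm M u" using False l2_norm_nonneg[of M u] by linarith
    ultimately show ?thesis by (simp add: t_def field_simps)
  qed
qed

lemma op_norm_op_diff_bound:
  assumes "bounded_op M A" "bounded_op M B" "op_norm M (op_diff A B) \<le> c" "u \<in> L2 M"
  shows "l2_norm M (\<lambda>x. A u x - B u x) \<le> c * l2_norm M u"
  using l2_norm_le_op_norm[OF bounded_op_op_diff[OF assms(1,2)] assms(4)]
    mult_right_mono[OF assms(3) l2_norm_nonneg[of M u]] by (simp add: op_diff_def)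

lemma bounded_op_tendsto:
  assumes A: "bounded_op M A" and x: "\<And>j. x j \<in> L2 M" and u: "u \<in> L2 M"
    and lim: "(\<lambda>j::nat. l2_norm M (\<lambda>t. x j t - u t)) \<longlonglongrightarrow> 0"
  shows "(\<lambda>j. l2_norm M (\<lambda>t. A (x j) t - A u t)) \<longlonglongrightarrow> 0"
proof -
  obtain C where C: "\<And>u. u \<in> L2 M \<Longrightarrow> l2_norm M (A u) \<le> C * l2_norm M u"
    using bounded_op_bound[OF A] by blast
  show ?thesis
  proof (rule tendsto_sandwich[OF _ _ tendsto_const])
    show "(\<lambda>j. C * l2_norm M (\<lambda>t. x j t - u t)) \<longlonglongrightarrow> 0"
      using tendsto_mult_left[OF lim, of C] by simp
  qed (use C in \<open>auto simp: l2_norm_bounded_op_diff[OF A x u] L2_diff x u\<close>)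
qed

section \<open>Projection onto the closure of a range\<close>

text \<open>The first-order condition at a minimum: a quadratic without constant term that is non-negative
  on the whole line has no linear term. The bad choice of \<open>t\<close> is the minimizer of the polynomial with
  \<open>Y + 1\<close> in place of \<open>Y\<close>, which exists also for \<open>Y = 0\<close>.\<close>

lemma quadratic_nonneg_imp_zero:
  fixes X Y :: real
  assumes nonneg: "\<And>t. 0 \<le> 2 * t * X + t\<^sup>2 * Y" and Y: "0 \<le> Y"
  shows "X = 0"
proof (rule ccontr)
  assume "X \<noteq> 0"
  have "2 * (- X / (Y + 1)) * X + (- X / (Y + 1))\<^sup>2 * Y = - (X\<^sup>2 * (Y + 2) / (Y + 1)\<^sup>2)"
    using Y by (simp add: divide_simps power2_eq_square) (simp add: algebra_simps)
  moreover have "0 < X\<^sup>2 * (Y + 2) / (Y + 1)\<^sup>2" using Y \<open>X \<noteq> 0\<close> by simp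
  ultimately show False using nonneg[of "- X / (Y + 1)"] by linarith
qed

text \<open>Here \<open>r\<close> is the component of \<open>y\<close> orthogonal to the range of \<open>B\<close>, and the \<open>B (v j)\<close> approximate the
  other component. Take a minimizing sequence for the distance from \<open>y\<close> to the range. The
  parallelogram identity turns near-minimality up to \<open>(1 / 4) ^ j\<close> into increments of size
  \<open>2 * (1 / 2) ^ j\<close>, so the residuals converge, and minimality along each line gives orthogonality.
  The summability of the increments is part of the conclusion because for coercive \<open>B\<close> it
  passes to the arguments \<open>v j\<close>.\<close>

lemma range_closure_projection:
  fixes y :: "'b \<Rightarrow> 'a::conj_scalar"
  assumes B: "bounded_op M B" and y: "y \<in> L2 M"
  obtains r v where "r \<in> L2 M" "\<And>j::nat. v j \<in> L2 M"
    "\<And>w. w \<in> L2 M \<Longrightarrow> l2_re_inner M r (B w) = 0"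
    "(\<lambda>j. l2_norm M (\<lambda>x. y x - B (v j) x - r x)) \<longlonglongrightarrow> 0"
    "summable (\<lambda>j. l2_norm M (\<lambda>x. B (v (Suc j)) x - B (v j) x))"
proof -
  note L2 = bounded_op_L2[OF B] y L2_closed
  define N where "N w = (l2_norm M (\<lambda>x. y x - B w x))\<^sup>2" for w
  define D where "D = (INF w\<in>L2 M. N w)"
  have bdd: "bdd_below (N ` L2 M)"
    by (rule bdd_belowI2[where m = 0]) (simp add: N_def)
  have D_le: "D \<le> N w" if "w \<in> L2 M" for w
    unfolding D_def using bdd that by (rule cINF_lower)
  have "\<exists>v\<in>L2 M. N v < D + (1 / 4) ^ j" for j :: nat
    unfolding D_def using bdd L2_zero[of M] by (subst cINF_less_iff[symmetric]) fastforce+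
  then obtain v where v: "\<And>j::nat. v j \<in> L2 M" and Nv: "\<And>j. N (v j) < D + (1 / 4) ^ j"
    by metis
  define p where "p j = (\<lambda>x. y x - B (v j) x)" for j
  have p: "p j \<in> L2 M" for j unfolding p_def by (intro L2 v)
  have p_norm: "(l2_norm M (p j))\<^sup>2 < D + (1 / 4) ^ j" for j
    using Nv[of j] by (simp add: N_def p_def)
  have near: "D \<le> (l2_norm M (p j))\<^sup>2 + 2 * t * l2_re_inner M (p j) (B w) + t\<^sup>2 * (l2_norm M (B w))\<^sup>2"
    if w: "w \<in> L2 M" for j t w
  proof -
    \<comment> \<open>Minimality is tested at a point of the range reached from \<open>B (v j)\<close> in direction \<open>B w\<close>.\<close>
    define z where "z = (\<lambda>x. v j x + of_real (- t) * w x)"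
    have z: "z \<in> L2 M" unfolding z_def by (intro L2 v w)
    have "l2_eq M (B z) (\<lambda>x. B (v j) x + B (\<lambda>x. of_real (- t) * w x) x)"
      unfolding z_def by (intro bounded_op_add[OF B] L2 v w)
    moreover have "l2_eq M (B (\<lambda>x. of_real (- t) * w x)) (\<lambda>x. of_real (- t) * B w x)"
      by (intro bounded_op_scale[OF B] w)
    ultimately have "l2_eq M (\<lambda>x. y x - B z x) (\<lambda>x. p j x + of_real t * B w x)"
      unfolding l2_eq_def p_def by eventually_elim simp
    then have "N z = (l2_norm M (\<lambda>x. p j x + of_real t * B w x))\<^sup>2"
      unfolding N_def by (subst l2_norm_cong) (auto intro!: L2 p z w)
    then show ?thesis
      using D_le[OF z] by (simp add: l2_norm_add_scale_power2[OF p L2(1)[OF w]])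
  qed
  have step: "l2_norm M (\<lambda>x. B (v (Suc j)) x - B (v j) x) \<le> 2 * (1 / 2) ^ j" for j
  proof -
    define w where "w = (\<lambda>x. v (Suc j) x - v j x)"
    have w: "w \<in> L2 M" unfolding w_def by (intro L2 v)
    have eq: "l2_eq M (B w) (\<lambda>x. B (v (Suc j)) x - B (v j) x)"
      unfolding w_def by (rule bounded_op_diff[OF B v v])
    have "l2_eq M (p (Suc j)) (\<lambda>x. p j x + of_real (- 1) * B w x)"
      using eq unfolding l2_eq_def p_def by eventually_elim simp
    then have "(l2_norm M (p (Suc j)))\<^sup>2 = (l2_norm M (\<lambda>x. p j x + of_real (- 1) * B w x))\<^sup>2"
      by (subst l2_norm_cong) (auto intro!: L2 p w)
    also have "\<dots> = (l2_norm M (p j))\<^sup>2 - 2 * l2_re_inner M (p j) (B w) + (l2_norm M (B w))\<^sup>2"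
      by (subst l2_norm_add_scale_power2[OF p L2(1)[OF w]]) simp
    \<comment> \<open>The parameter \<open>- 1 / 2\<close> selects the midpoint of the residuals \<open>p j\<close> and \<open>p (Suc j)\<close>.\<close>
    finally have "(l2_norm M (B w))\<^sup>2 / 2
        \<le> (l2_norm M (p j))\<^sup>2 + (l2_norm M (p (Suc j)))\<^sup>2 - 2 * D"
      using near[OF w, of j "- 1 / 2"] by (simp add: power2_eq_square)
    also have "\<dots> \<le> 2 * (1 / 4) ^ j"
    proof -
      have "(0 :: real) \<le> (1 / 4) ^ j" by (intro zero_le_power) simp
      moreover have "(l2_norm M (p (Suc j)))\<^sup>2 < D + (1 / 4) ^ j / 4" using p_norm[of "Suc j"] by simp
      ultimately show ?thesis using p_norm[of j] by linarith
    qed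
    finally have "(l2_norm M (B w))\<^sup>2 \<le> (2 * (1 / 2) ^ j)\<^sup>2"
      by (simp add: power_mult_distrib power2_eq_square power_mult_distrib[symmetric])
    then have "l2_norm M (B w) \<le> 2 * (1 / 2) ^ j"
      by (rule power2_le_imp_le) simp
    then show ?thesis using l2_norm_cong[OF eq] by (simp add: L2 v w)
  qed
  have sm: "summable (\<lambda>j. l2_norm M (\<lambda>x. B (v (Suc j)) x - B (v j) x))"
    by (rule summable_comparison_test'[where g = "\<lambda>j. 2 * (1 / 2) ^ j" and N = 0])
       (use step in \<open>auto intro!: summable_mult summable_geometric\<close>)
  have "l2_norm M (\<lambda>x. p (Suc j) x - p j x) = l2_norm M (\<lambda>x. B (v (Suc j)) x - B (v j) x)" for j
    using l2_norm_diff_commute[of M "B (v j)" "B (v (Suc j))"] by (simp add: p_def)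
  then obtain r where r: "r \<in> L2 M" and lim: "(\<lambda>j. l2_norm M (\<lambda>x. p j x - r x)) \<longlonglongrightarrow> 0"
    using L2_complete[of p, OF p] sm by auto
  have orth: "l2_re_inner M r (B w) = 0" if w: "w \<in> L2 M" for w
  proof (rule quadratic_nonneg_imp_zero)
    fix t
    have "(\<lambda>j. (1 / 4) ^ j + (2 * t * l2_re_inner M (p j) (B w) + t\<^sup>2 * (l2_norm M (B w))\<^sup>2))
        \<longlonglongrightarrow> 0 + (2 * t * l2_re_inner M r (B w) + t\<^sup>2 * (l2_norm M (B w))\<^sup>2)"
      by (intro tendsto_intros LIMSEQ_realpow_zero l2_re_inner_tendsto[OF p r L2(1)[OF w] lim]) auto
    moreover have "0 \<le> (1 / 4) ^ j + (2 * t * l2_re_inner M (p j) (B w) + t\<^sup>2 * (l2_norm M (B w))\<^sup>2)" for j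
      using near[OF w, of j t] p_norm[of j] by linarith
    ultimately show "0 \<le> 2 * t * l2_re_inner M r (B w) + t\<^sup>2 * (l2_norm M (B w))\<^sup>2"
      by (auto intro: LIMSEQ_le_const)
  qed simp
  show ?thesis by (rule that[OF r v orth _ sm]) (use lim in \<open>simp_all add: p_def\<close>)
qed

lemma adjoint_l2_re_inner:
  "is_adjoint M K Kadj \<Longrightarrow> u \<in> L2 M \<Longrightarrow> v \<in> L2 M \<Longrightarrow>
    l2_re_inner M (K u) v = l2_re_inner M u (Kadj v)"
  by (simp add: is_adjoint_def l2_re_inner_def)

text \<open>The orthogonal complement of the nullspace of \<open>K\<close> lies in the closure of the range of \<open>K\<^sup>*K\<close>.
  Let \<open>r\<close> be the component of \<open>y\<close> orthogonal to that range. Testing with \<open>K\<^sup>*K r\<close> gives \<open>K r = 0\<close>, hence \<open>r\<close> is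
  orthogonal to \<open>y\<close>; it is also orthogonal to the range, hence to its own approximations
  \<open>y - K\<^sup>*K v\<^sub>j\<close>, and therefore to itself.\<close>

lemma orthogonal_nullspace_approx:
  fixes y :: "'b \<Rightarrow> 'a::conj_scalar"
  assumes K: "bounded_op M K" and adj: "is_adjoint M K Kadj" and y: "y \<in> L2 M"
    and orth: "\<forall>v\<in>nullspace M K. l2_inner M y v = 0" and e: "0 < e"
  shows "\<exists>v\<in>L2 M. l2_norm M (\<lambda>x. y x - Kadj (K v) x) < e"
proof -
  have Kadj: "bounded_op M Kadj" using adj by (simp add: is_adjoint_def)
  note L2 = bounded_op_L2[OF K] bounded_op_L2[OF Kadj]
  obtain r v where r: "r \<in> L2 M" and v: "\<And>j::nat. v j \<in> L2 M"
    and rw: "\<And>w. w \<in> L2 M \<Longrightarrow> l2_re_inner M r (Kadj (K w)) = 0"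
    and lim: "(\<lambda>j. l2_norm M (\<lambda>x. y x - Kadj (K (v j)) x - r x)) \<longlonglongrightarrow> 0"
    by (rule range_closure_projection[OF bounded_op_comp[OF Kadj K] y, unfolded o_def]) blast
  have "(l2_norm M (K r))\<^sup>2 = l2_re_inner M r (Kadj (K r))"
    using adjoint_l2_re_inner[OF adj r L2(1)[OF r]] by (simp add: l2_re_inner_self L2 r)
  then have "l2_norm M (K r) = 0" by (simp add: rw r)
  then have "r \<in> nullspace M K"
    by (simp add: nullspace_def r l2_norm_eq_0_iff L2)
  then have yr: "l2_re_inner M y r = 0"
    using orth re_part_of_real[of 0, where 'a='a] by (simp add: l2_re_inner_def)
  have p: "(\<lambda>x. y x - Kadj (K (v j)) x) \<in> L2 M" for j
    by (intro L2_diff y L2 v)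
  have "l2_re_inner M (\<lambda>x. y x - Kadj (K (v j)) x) r = 0" for j
    using l2_re_inner_commute[of r M "Kadj (K (v j))"] rw[OF v[of j]] yr
    by (simp add: l2_re_inner_diff_left y L2 v r)
  then have "l2_re_inner M r r = 0"
    using l2_re_inner_tendsto[OF p r r lim] by (simp add: LIMSEQ_const_iff)
  then have r0: "l2_norm M r = 0" by (simp add: l2_re_inner_self r)
  obtain j where j: "l2_norm M (\<lambda>x. y x - Kadj (K (v j)) x - r x) < e"
    using order_tendstoD(2)[OF lim e] by (auto simp: eventually_sequentially)
  have "l2_norm M (\<lambda>x. y x - Kadj (K (v j)) x)
      \<le> l2_norm M (\<lambda>x. y x - Kadj (K (v j)) x - r x) + l2_norm M r"
    using l2_norm_triangle[OF L2_diff[OF p[of j] r] r] by simp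
  also have "\<dots> < e" using j r0 by simp
  finally show ?thesis using v by blast
qed

text \<open>Lax-Milgram: coercivity leaves no room for a residual orthogonal to the range, and it bounds
  \<open>norm w\<close> by \<open>norm (A w) / c\<close>, so convergence of the images \<open>A (v j)\<close> forces convergence of the \<open>v j\<close>.\<close>

lemma coercive_bounded_op_surj:
  fixes g :: "'b \<Rightarrow> 'a::conj_scalar"
  assumes A: "bounded_op M A" and c: "0 < c"
    and coercive: "\<And>w. w \<in> L2 M \<Longrightarrow> c * (l2_norm M w)\<^sup>2 \<le> l2_re_inner M (A w) w"
    and g: "g \<in> L2 M"
  shows "\<exists>w\<in>L2 M. l2_eq M (A w) g"
proof -
  note L2 = bounded_op_L2[OF A]
  have below: "l2_norm M w \<le> l2_norm M (A w) / c" if w: "w \<in> L2 M" for w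
  proof (cases "l2_norm M w = 0")
    case False
    then have pos: "0 < l2_norm M w" using l2_norm_nonneg[of M w] by linarith
    have "(c * l2_norm M w) * l2_norm M w \<le> l2_norm M (A w) * l2_norm M w"
      using coercive[OF w] l2_Cauchy_Schwarz[OF L2[OF w] w] by (simp add: power2_eq_square)
    then show ?thesis using pos c by (simp add: field_simps)
  qed (use c in simp)
  obtain r v where r: "r \<in> L2 M" and v: "\<And>j::nat. v j \<in> L2 M"
    and rw: "\<And>w. w \<in> L2 M \<Longrightarrow> l2_re_inner M r (A w) = 0"
    and lim: "(\<lambda>j. l2_norm M (\<lambda>x. g x - A (v j) x - r x)) \<longlonglongrightarrow> 0"
    and sm: "summable (\<lambda>j. l2_norm M (\<lambda>x. A (v (Suc j)) x - A (v j) x))"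
    by (rule range_closure_projection[OF A g]) blast
  have r0: "l2_norm M r = 0"
    using coercive[OF r] rw[OF r] l2_re_inner_commute[OF L2[OF r] r] c
    by (simp add: mult_le_0_iff)
  have "summable (\<lambda>j. l2_norm M (\<lambda>x. v (Suc j) x - v j x))"
  proof (rule summable_comparison_test'[where N = 0])
    show "summable (\<lambda>j. l2_norm M (\<lambda>x. A (v (Suc j)) x - A (v j) x) / c)"
      using sm by (rule summable_divide)
  qed (use below[OF L2_diff[OF v v]] in \<open>simp add: l2_norm_bounded_op_diff[OF A v v]\<close>)
  then obtain w where w: "w \<in> L2 M" and wlim: "(\<lambda>j. l2_norm M (\<lambda>x. v j x - w x)) \<longlonglongrightarrow> 0"
    using L2_complete[of v, OF v] by auto
  have "(\<lambda>j. l2_norm M (\<lambda>x. A (v j) x - A w x) +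
          (l2_norm M (\<lambda>x. g x - A (v j) x - r x) + l2_norm M r)) \<longlonglongrightarrow> 0 + (0 + 0)"
    using bounded_op_tendsto[OF A v w wlim] lim by (intro tendsto_add) (auto simp: r0)
  moreover have "l2_norm M (\<lambda>x. g x - A w x) \<le> l2_norm M (\<lambda>x. A (v j) x - A w x) +
      (l2_norm M (\<lambda>x. g x - A (v j) x - r x) + l2_norm M r)" for j
    using l2_norm_diff_triangle[OF g L2[OF v[of j]] L2[OF w]]
      l2_norm_triangle[OF L2_diff[OF L2_diff[OF g L2[OF v[of j]]] r] r] by simp
  ultimately have "l2_norm M (\<lambda>x. g x - A w x) \<le> 0"
    by (auto intro: LIMSEQ_le_const)
  then have "l2_norm M (\<lambda>x. A w x - g x) = 0"
    using l2_norm_nonneg[of M "\<lambda>x. g x - A w x"] l2_norm_diff_commute[of M "A w" g] by linarith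
  then show ?thesis using w by (auto simp: l2_eq_iff_l2_norm_diff L2 g)
qed

section \<open>Stability of the perturbed normal equation\<close>

text \<open>The exact operator satisfies \<open>\<langle>K\<^sup>*K w, w\<rangle> = \<bar>K w\<bar>\<^sup>2\<close>; an error of operator norm \<open>a / 2\<close> can use up
  only half of the coercivity which the shift by \<open>a\<close> provides.\<close>

lemma perturbed_inner_ge:
  assumes K: "bounded_op M K" and adj: "is_adjoint M K Kadj"
    and w: "w \<in> L2 M" and Sw: "S w \<in> L2 M"
    and dS: "l2_norm M (\<lambda>x. Kadj (K w) x - S w x) \<le> a / 2 * l2_norm M w"
  shows "(l2_norm M (K w))\<^sup>2 - a / 2 * (l2_norm M w)\<^sup>2 \<le> l2_re_inner M (S w) w"
proof -
  have Kadj: "bounded_op M Kadj" using adj by (simp add: is_adjoint_def)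
  note L2 = bounded_op_L2[OF K] bounded_op_L2[OF Kadj] w Sw
  have "(l2_norm M (K w))\<^sup>2 = l2_re_inner M (Kadj (K w)) w"
    using adjoint_l2_re_inner[OF adj w L2(1)[OF w]] l2_re_inner_commute[of w M "Kadj (K w)"]
    by (simp add: l2_re_inner_self L2)
  moreover have "l2_re_inner M (\<lambda>x. Kadj (K w) x - S w x) w \<le> (a / 2 * l2_norm M w) * l2_norm M w"
    by (rule order_trans[OF l2_Cauchy_Schwarz mult_right_mono[OF dS]]) (auto intro!: L2_diff L2)
  ultimately show ?thesis
    by (simp add: l2_re_inner_diff_left L2 power2_eq_square)
qed

lemma op_shift_inner:
  assumes "w \<in> L2 M" "S w \<in> L2 M"
  shows "l2_re_inner M (op_shift S a w) w = l2_re_inner M (S w) w + a * (l2_norm M w)\<^sup>2"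
  using assms
  by (simp add: op_shift_def l2_re_inner_add_left L2_scale l2_re_inner_scale_left l2_re_inner_self)

text \<open>The term \<open>\<gamma> * \<kappa>\<close> is absorbed into \<open>\<kappa>\<^sup>2\<close> at the cost of \<open>\<gamma>\<^sup>2 / 4\<close>. What remains is a quadratic inequality
  in \<open>n\<close> that fails as soon as \<open>b\<^sup>2 * n\<close> exceeds \<open>2 * \<gamma> * b + 2 * \<eta>\<close>.\<close>

lemma energy_inequality_solve:
  fixes b n \<gamma> \<eta> \<kappa> :: real
  assumes b: "0 < b" and nonneg: "0 \<le> n" "0 \<le> \<gamma>" "0 \<le> \<eta>"
    and energy: "\<kappa>\<^sup>2 + b\<^sup>2 / 2 * n\<^sup>2 \<le> b / 2 * \<gamma> * n + \<gamma> * \<kappa> + \<eta> * n"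
  shows "n \<le> 2 * \<gamma> / b + 2 * \<eta> / b\<^sup>2"
proof (rule ccontr)
  assume "\<not> ?thesis"
  then have "b\<^sup>2 * (2 * \<gamma> / b + 2 * \<eta> / b\<^sup>2) < b\<^sup>2 * n"
    using b by (intro mult_strict_left_mono) auto
  then have *: "2 * \<gamma> * b + 2 * \<eta> < b\<^sup>2 * n"
    using b by (simp add: distrib_left power2_eq_square mult_ac)
  have n: "0 < n"
  proof (rule ccontr)
    assume "\<not> 0 < n"
    then have "n = 0" using nonneg by simp
    moreover have "0 \<le> \<gamma> * b" using b nonneg by simp
    ultimately show False using * nonneg by simp
  qed
  have "b * (2 * \<gamma>) < b * (b * n)"
    using * nonneg by (simp add: power2_eq_square mult_ac)
  then have **: "2 * \<gamma> < b * n" using b by (simp only: mult_less_cancel_left_pos)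
  have "0 \<le> (\<kappa> - \<gamma> / 2)\<^sup>2" by simp
  then have "\<gamma> * \<kappa> \<le> \<gamma>\<^sup>2 / 4 + \<kappa>\<^sup>2" by (simp add: power2_diff power_divide mult.commute)
  then have "n / 2 * (b\<^sup>2 * n) \<le> b / 2 * \<gamma> * n + \<gamma>\<^sup>2 / 4 + \<eta> * n"
    using energy by (simp add: power2_eq_square mult_ac)
  moreover have "n / 2 * (2 * \<gamma> * b + 2 * \<eta>) < n / 2 * (b\<^sup>2 * n)"
    using * n by (intro mult_strict_left_mono) auto
  ultimately have "\<gamma> * (b * n) / 2 < \<gamma>\<^sup>2 / 4" by (simp add: algebra_simps)
  moreover have "\<gamma> * (2 * \<gamma>) \<le> \<gamma> * (b * n)"
    using ** nonneg by (intro mult_left_mono) auto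
  moreover have "0 \<le> \<gamma>\<^sup>2" by simp
  ultimately show False unfolding power2_eq_square by linarith
qed

text \<open>The decisive stability estimate. A right-hand side of the form \<open>R g\<close>, with \<open>R\<close> close to the adjoint,
  costs only a factor \<open>1 / sqrt a\<close>, while a general one costs \<open>1 / a\<close>. Pairing the equation with \<open>w\<close> shows
  why: \<open>\<langle>K\<^sup>* g, w\<rangle> = \<langle>g, K w\<rangle>\<close>, and \<open>\<bar>K w\<bar>\<^sup>2\<close> is available on the left-hand side to absorb it.\<close>

lemma perturbed_normal_equation_bound:
  assumes K: "bounded_op M K" and adj: "is_adjoint M K Kadj" and a: "0 < a"
    and w: "w \<in> L2 M" and g: "g \<in> L2 M" and h: "h \<in> L2 M"
    and Sw: "S w \<in> L2 M" and Rg: "R g \<in> L2 M"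
    and dS: "l2_norm M (\<lambda>x. Kadj (K w) x - S w x) \<le> a / 2 * l2_norm M w"
    and dR: "l2_norm M (\<lambda>x. R g x - Kadj g x) \<le> sqrt a / 2 * l2_norm M g"
    and eq: "l2_eq M (op_shift S a w) (\<lambda>x. R g x + h x)"
  shows "l2_norm M w \<le> 2 * l2_norm M g / sqrt a + 2 * l2_norm M h / a"
proof -
  have Kadj: "bounded_op M Kadj" using adj by (simp add: is_adjoint_def)
  note L2 = bounded_op_L2[OF K] bounded_op_L2[OF Kadj] w g h Sw Rg L2_closed
  have "l2_re_inner M (S w) w + a * (l2_norm M w)\<^sup>2 = l2_re_inner M (\<lambda>x. R g x + h x) w"
    unfolding op_shift_inner[of w M S a, OF w Sw, symmetric]
    by (rule l2_re_inner_cong[OF eq]) (auto simp: op_shift_def intro!: L2)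
  also have "\<dots> = l2_re_inner M (R g) w + l2_re_inner M h w"
    by (rule l2_re_inner_add_left) (intro L2)+
  also have "l2_re_inner M (R g) w = l2_re_inner M (\<lambda>x. R g x - Kadj g x) w + l2_re_inner M g (K w)"
    using adjoint_l2_re_inner[OF adj w g] l2_re_inner_commute[of w M "Kadj g"]
      l2_re_inner_commute[of g M "K w"]
    by (simp add: l2_re_inner_diff_left L2)
  also have "l2_re_inner M (\<lambda>x. R g x - Kadj g x) w \<le> (sqrt a / 2 * l2_norm M g) * l2_norm M w"
    by (rule order_trans[OF l2_Cauchy_Schwarz mult_right_mono[OF dR]]) (auto intro!: L2)
  also have "l2_re_inner M g (K w) \<le> l2_norm M g * l2_norm M (K w)"
    by (rule l2_Cauchy_Schwarz) (intro L2)+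
  also have "l2_re_inner M h w \<le> l2_norm M h * l2_norm M w"
    by (rule l2_Cauchy_Schwarz) (intro L2)+
  finally have "(l2_norm M (K w))\<^sup>2 + (sqrt a)\<^sup>2 / 2 * (l2_norm M w)\<^sup>2
      \<le> sqrt a / 2 * l2_norm M g * l2_norm M w + l2_norm M g * l2_norm M (K w) + l2_norm M h * l2_norm M w"
    using perturbed_inner_ge[of M K Kadj w S a, OF K adj w Sw dS] a by simp
  then show ?thesis
    using energy_inequality_solve[of "sqrt a" "l2_norm M w" "l2_norm M g" "l2_norm M h" "l2_norm M (K w)"] a
    by simp
qed

lemma op_inv_solves:
  assumes "\<exists>w\<in>L2 M. l2_eq M (A w) g"
  shows "op_inv M A g \<in> L2 M" "l2_eq M (A (op_inv M A g)) g"
  using someI_ex[of "\<lambda>w. w \<in> L2 M \<and> l2_eq M (A w) g"] assms unfolding op_inv_def by blast+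

text \<open>One regularization step. With \<open>A = S + a I\<close> and an arbitrary \<open>v\<close>, the shifted error \<open>e = w - y + a v\<close> solves
  \<open>A e = R (g - f) + (R K - S) y - a (y - K\<^sup>*K v) - a (K\<^sup>*K v - S v) + a\<^sup>2 v\<close>,
  because \<open>f = K y\<close>. The terms after \<open>R (g - f)\<close> have norms of order \<open>a\<^sup>2\<close>, except for \<open>a (y - K\<^sup>*K v)\<close>;
  division by \<open>a\<close> in the stability estimate thus leaves \<open>O(a)\<close> and twice the distance from \<open>y\<close> to \<open>K\<^sup>*K v\<close>.\<close>

lemma regularized_solution_error:
  assumes K: "bounded_op M K" and adj: "is_adjoint M K Kadj" and a: "0 < a"
    and S: "bounded_op M S" and R: "bounded_op M R"
    and dS: "\<And>u. u \<in> L2 M \<Longrightarrow> l2_norm M (\<lambda>x. Kadj (K u) x - S u x) \<le> a / 2 * l2_norm M u"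
    and dSR: "\<And>u. u \<in> L2 M \<Longrightarrow> l2_norm M (\<lambda>x. S u x - R (K u) x) \<le> a\<^sup>2 * l2_norm M u"
    and dR: "\<And>u. u \<in> L2 M \<Longrightarrow> l2_norm M (\<lambda>x. R u x - Kadj u x) \<le> sqrt a / 2 * l2_norm M u"
    and y: "y \<in> L2 M" and v: "v \<in> L2 M" and f: "f \<in> L2 M" and g: "g \<in> L2 M"
    and Ky: "l2_eq M (K y) f"
    and w_def: "w = op_inv M (op_shift S a) (R g)"
  shows "w \<in> L2 M"
    and "l2_norm M (\<lambda>x. w x - y x) \<le> 2 * l2_norm M (\<lambda>x. g x - f x) / sqrt a
      + 2 * l2_norm M (\<lambda>x. y x - Kadj (K v) x) + a * (2 * l2_norm M y + 4 * l2_norm M v)"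
proof -
  have Kadj: "bounded_op M Kadj" using adj by (simp add: is_adjoint_def)
  have A: "bounded_op M (op_shift S a)" by (rule bounded_op_op_shift[OF S])
  note L2 = bounded_op_L2[OF K] bounded_op_L2[OF Kadj] bounded_op_L2[OF S] bounded_op_L2[OF R]
    y v f g L2_closed
  have "a / 2 * (l2_norm M u)\<^sup>2 \<le> l2_re_inner M (op_shift S a u) u" if u: "u \<in> L2 M" for u
  proof -
    have "0 \<le> (l2_norm M (K u))\<^sup>2" by simp
    then show ?thesis
      using perturbed_inner_ge[of M K Kadj u S a, OF K adj u L2(3)[OF u] dS[OF u]]
        op_shift_inner[of u M S a, OF u L2(3)[OF u]] by linarith
  qed
  then have ex: "\<exists>w\<in>L2 M. l2_eq M (op_shift S a w) (R g)"
    using a by (intro coercive_bounded_op_surj[OF A, of "a / 2"] L2) auto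
  show w: "w \<in> L2 M" unfolding w_def by (rule op_inv_solves[OF ex])
  have Aw: "l2_eq M (op_shift S a w) (R g)" unfolding w_def by (rule op_inv_solves[OF ex])
  \<comment> \<open>\<open>h\<close> collects all of the right-hand side of the equation for \<open>e\<close> except \<open>R (g - f)\<close>.\<close>
  define e where "e = (\<lambda>x. (w x - y x) + of_real a * v x)"
  define h1 where "h1 = (\<lambda>x. S y x - R (K y) x)"
  define h2 where "h2 = (\<lambda>x. y x - Kadj (K v) x)"
  define h3 where "h3 = (\<lambda>x. Kadj (K v) x - S v x)"
  define h23 where "h23 = (\<lambda>x. of_real (- a) * h2 x + of_real (- a) * h3 x)"
  define h123 where "h123 = (\<lambda>x. h23 x - h1 x)"
  define h where "h = (\<lambda>x. h123 x + of_real (a\<^sup>2) * v x)"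
  have hL2: "h1 \<in> L2 M" "h2 \<in> L2 M" "h3 \<in> L2 M" unfolding h1_def h2_def h3_def by (intro L2)+
  have h23: "h23 \<in> L2 M" unfolding h23_def by (intro L2 hL2)
  have h123: "h123 \<in> L2 M" unfolding h123_def by (intro L2 hL2 h23)
  have h: "h \<in> L2 M" unfolding h_def by (intro L2 h123)
  have e: "e \<in> L2 M" unfolding e_def by (intro L2 w)
  have h_norm: "l2_norm M h \<le> a * l2_norm M h2 + a * (a / 2 * l2_norm M v) + a\<^sup>2 * l2_norm M y + a\<^sup>2 * l2_norm M v"
  proof -
    have "l2_norm M h \<le> l2_norm M h123 + a\<^sup>2 * l2_norm M v"
      using l2_norm_triangle[OF h123 L2_scale[OF v], of "of_real (a\<^sup>2)"]
      by (simp add: h_def l2_norm_scale norm_power)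
    moreover have "l2_norm M h123 \<le> l2_norm M h23 + l2_norm M h1"
      unfolding h123_def by (rule l2_norm_triangle_diff[OF h23 hL2(1)])
    moreover have "l2_norm M h23 \<le> a * l2_norm M h2 + a * l2_norm M h3"
      using l2_norm_triangle[OF L2_scale[OF hL2(2)] L2_scale[OF hL2(3)], of "of_real (- a)" "of_real (- a)"] a
      by (simp only: h23_def l2_norm_scale norm_of_real)
    moreover have "a * l2_norm M h3 \<le> a * (a / 2 * l2_norm M v)"
      using dS[OF v] a by (intro mult_left_mono) (auto simp: h3_def)
    moreover have "l2_norm M h1 \<le> a\<^sup>2 * l2_norm M y"
      using dSR[OF y] by (simp add: h1_def)
    ultimately show ?thesis by linarith
  qed
  have "l2_eq M (op_shift S a e) (\<lambda>x. R (\<lambda>x. g x - f x) x + h x)"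
  proof -
    have 1: "l2_eq M (op_shift S a e)
        (\<lambda>x. op_shift S a (\<lambda>x. w x - y x) x + op_shift S a (\<lambda>x. of_real a * v x) x)"
      unfolding e_def by (intro bounded_op_add[OF A] L2 w)
    have 2: "l2_eq M (op_shift S a (\<lambda>x. w x - y x)) (\<lambda>x. op_shift S a w x - op_shift S a y x)"
      by (rule bounded_op_diff[OF A w y])
    have 3: "l2_eq M (op_shift S a (\<lambda>x. of_real a * v x)) (\<lambda>x. of_real a * op_shift S a v x)"
      by (rule bounded_op_scale[OF A v])
    have 4: "l2_eq M (R (\<lambda>x. g x - f x)) (\<lambda>x. R g x - R f x)"
      by (rule bounded_op_diff[OF R g f])
    have 5: "l2_eq M (R (K y)) (R f)"
      by (rule bounded_op_cong[OF R Ky L2(1)[OF y] f])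
    show ?thesis
      using 1 2 3 4 5 Aw unfolding l2_eq_def
    proof eventually_elim
      case (elim x)
      have "op_shift S a e x = R g x - (S y x + of_real a * y x) + of_real a * (S v x + of_real a * v x)"
        using elim by (simp add: op_shift_def)
      moreover have "R (\<lambda>x. g x - f x) x = R g x - R (K y) x" using elim by simp
      ultimately show ?case
        by (simp add: h_def h123_def h23_def h1_def h2_def h3_def algebra_simps power2_eq_square)
    qed
  qed
  then have "l2_norm M e \<le> 2 * l2_norm M (\<lambda>x. g x - f x) / sqrt a + 2 * l2_norm M h / a"
    by (intro perturbed_normal_equation_bound[where K = K and Kadj = Kadj and S = S and R = R]
        K adj a e h dS dR L2)
  also have "2 * l2_norm M h / a \<le> 2 * (a * l2_norm M h2 + a * (a / 2 * l2_norm M v) + a\<^sup>2 * l2_norm M y + a\<^sup>2 * l2_norm M v) / a"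
    using h_norm a by (intro divide_right_mono mult_left_mono) auto
  also have "\<dots> = 2 * l2_norm M h2 + a * (2 * l2_norm M y + 3 * l2_norm M v)"
    using a by (simp add: field_simps power2_eq_square)
  finally have "l2_norm M e \<le> 2 * l2_norm M (\<lambda>x. g x - f x) / sqrt a + 2 * l2_norm M h2 + a * (2 * l2_norm M y + 3 * l2_norm M v)"
    by simp
  moreover have "l2_norm M (\<lambda>x. w x - y x) \<le> l2_norm M e + a * l2_norm M v"
    using l2_norm_triangle_diff[OF e L2_scale[OF v], of "of_real a"] a by (simp add: e_def l2_norm_scale)
  ultimately show "l2_norm M (\<lambda>x. w x - y x) \<le> 2 * l2_norm M (\<lambda>x. g x - f x) / sqrt a
      + 2 * l2_norm M (\<lambda>x. y x - Kadj (K v) x) + a * (2 * l2_norm M y + 4 * l2_norm M v)"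
    unfolding h2_def by (simp add: algebra_simps)
qed

section \<open>The averaged iteration\<close>

text \<open>The iterate is a convex combination of the regularized solutions with weights \<open>(1 - q) * q ^ (n - i)\<close> and of
  zero with weight \<open>q ^ n\<close>. Since \<open>a\<close> decreases, the noise term of each step is at most the last one. The
  contributions \<open>a i * C\<close> all receive the same total factor, \<open>q ^ (n - i) * a i = \<alpha>0 * q ^ n\<close>, which is where
  the factor \<open>n\<close> in the bound comes from.\<close>

lemma iterate_error:
  fixes y g :: "'b \<Rightarrow> 'a::conj_scalar" and M :: "'b measure" and Tm Km :: "nat \<Rightarrow> ('b \<Rightarrow> 'a) \<Rightarrow> ('b \<Rightarrow> 'a)"
    and m :: "nat \<Rightarrow> nat" and a :: "nat \<Rightarrow> real"
  defines "w \<equiv> \<lambda>i. op_inv M (op_shift (Tm (m i)) (a i)) (Km (m i) g)"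
  assumes q: "0 < q" "q < 1" and \<alpha>0: "0 < \<alpha>0" and a_eq: "a = (\<lambda>i. \<alpha>0 * q ^ i)"
    and nonneg: "0 \<le> \<delta>" "0 \<le> \<epsilon>" and y: "y \<in> L2 M"
    and w: "\<And>i. 1 \<le> i \<Longrightarrow> w i \<in> L2 M"
    and w_err: "\<And>i. 1 \<le> i \<Longrightarrow> l2_norm M (\<lambda>x. w i x - y x) \<le> \<delta> / sqrt (a i) + \<epsilon> + a i * C"
  shows "iterate M q a Tm Km m g n \<in> L2 M \<and>
    l2_norm M (\<lambda>x. iterate M q a Tm Km m g n x - y x)
      \<le> \<delta> / sqrt (a n) + \<epsilon> + q ^ n * (l2_norm M y + n * ((1 - q) * \<alpha>0 * C))"
proof (induction n)
  case 0
  show ?case using nonneg \<alpha>0 by (simp add: a_eq)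
next
  case (Suc n)
  define U where "U = iterate M q a Tm Km m g"
  define E where "E = l2_norm M y + n * ((1 - q) * \<alpha>0 * C)"
  have U: "U n \<in> L2 M" using Suc by (simp add: U_def)
  have wn: "w (Suc n) \<in> L2 M" by (rule w) simp
  have U_Suc: "U (Suc n) = (\<lambda>x. of_real q * U n x + of_real (1 - q) * w (Suc n) x)"
    by (simp add: U_def w_def)
  have a_pos: "0 < a i" for i using q \<alpha>0 by (simp add: a_eq)
  have a_mono: "a (Suc n) \<le> a n" using q \<alpha>0 by (simp add: a_eq mult_left_le_one_le)
  have "l2_norm M (\<lambda>x. U (Suc n) x - y x)
      = l2_norm M (\<lambda>x. of_real q * (U n x - y x) + of_real (1 - q) * (w (Suc n) x - y x))"
    by (simp add: U_Suc algebra_simps)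
  also have "\<dots> \<le> l2_norm M (\<lambda>x. of_real q * (U n x - y x))
      + l2_norm M (\<lambda>x. of_real (1 - q) * (w (Suc n) x - y x))"
    by (intro l2_norm_triangle L2_scale L2_diff U wn y)
  also have "\<dots> = q * l2_norm M (\<lambda>x. U n x - y x) + (1 - q) * l2_norm M (\<lambda>x. w (Suc n) x - y x)"
    unfolding l2_norm_scale norm_of_real using q by simp
  also have "\<dots> \<le> q * (\<delta> / sqrt (a (Suc n)) + \<epsilon> + q ^ n * E)
      + (1 - q) * (\<delta> / sqrt (a (Suc n)) + \<epsilon> + a (Suc n) * C)"
  proof (intro add_mono mult_left_mono)
    have "\<delta> / sqrt (a n) \<le> \<delta> / sqrt (a (Suc n))"
      using nonneg a_pos a_mono by (intro divide_left_mono mult_pos_pos) auto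
    then show "l2_norm M (\<lambda>x. U n x - y x) \<le> \<delta> / sqrt (a (Suc n)) + \<epsilon> + q ^ n * E"
      using Suc by (simp add: U_def E_def)
    show "l2_norm M (\<lambda>x. w (Suc n) x - y x) \<le> \<delta> / sqrt (a (Suc n)) + \<epsilon> + a (Suc n) * C"
      by (rule w_err) simp
  qed (use q in auto)
  also have "\<dots> = \<delta> / sqrt (a (Suc n)) + \<epsilon> + q ^ Suc n * (E + (1 - q) * \<alpha>0 * C)"
  proof -
    have "a (Suc n) = q * \<alpha>0 * q ^ n" by (simp add: a_eq)
    then have "(1 - q) * (a (Suc n) * C) = q ^ Suc n * ((1 - q) * \<alpha>0 * C)" by simp
    moreover have "q * (X + q ^ n * E) + (1 - q) * (X + Y) = X + q ^ Suc n * E + (1 - q) * Y" for X Y :: real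
      by (simp add: algebra_simps)
    from this[of "\<delta> / sqrt (a (Suc n)) + \<epsilon>" "a (Suc n) * C"]
    have "q * (\<delta> / sqrt (a (Suc n)) + \<epsilon> + q ^ n * E) + (1 - q) * (\<delta> / sqrt (a (Suc n)) + \<epsilon> + a (Suc n) * C)
        = \<delta> / sqrt (a (Suc n)) + \<epsilon> + q ^ Suc n * E + (1 - q) * (a (Suc n) * C)" .
    ultimately show ?thesis by (simp only: distrib_left[of "q ^ Suc n"] add.assoc)
  qed
  also have "E + (1 - q) * \<alpha>0 * C = l2_norm M y + Suc n * ((1 - q) * \<alpha>0 * C)"
    by (simp add: E_def algebra_simps)
  finally have "l2_norm M (\<lambda>x. U (Suc n) x - y x)
      \<le> \<delta> / sqrt (a (Suc n)) + \<epsilon> + q ^ Suc n * (l2_norm M y + Suc n * ((1 - q) * \<alpha>0 * C))" .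
  moreover have "U (Suc n) \<in> L2 M"
    unfolding U_Suc by (intro L2_add L2_scale U wn)
  ultimately show ?case by (simp only: U_def)
qed

section \<open>Integral operators with continuous kernel\<close>

lemma L2_dominated:
  fixes u :: "'b \<Rightarrow> 'a::conj_scalar" and v :: "'b \<Rightarrow> 'c::conj_scalar"
  assumes u [measurable]: "u \<in> borel_measurable M" and v: "v \<in> L2 M"
    and le: "AE x in M. norm (u x) \<le> norm (v x)"
  shows "u \<in> L2 M" "l2_norm M u \<le> l2_norm M v"
proof -
  have "(\<integral>\<^sup>+x. ennreal ((norm (u x))\<^sup>2) \<partial>M) \<le> (\<integral>\<^sup>+x. ennreal ((norm (v x))\<^sup>2) \<partial>M)"
  proof (rule nn_integral_mono_AE)
    show "AE x in M. ennreal ((norm (u x))\<^sup>2) \<le> ennreal ((norm (v x))\<^sup>2)"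
      using le by eventually_elim (auto intro!: ennreal_leI power_mono)
  qed
  then show "u \<in> L2 M" "l2_norm M u \<le> l2_norm M v"
    using L2_if_nn_integral_le[OF u l2_norm_nonneg[of M v]] by (auto simp: nn_integral_L2[OF v])
qed

lemma (in finite_measure) L2_one: "(\<lambda>x. 1 :: real) \<in> L2 M"
  by (simp add: L2_def)

lemma (in finite_measure) L2_integrable:
  fixes u :: "'a \<Rightarrow> 'b::conj_scalar"
  assumes u: "u \<in> L2 M"
  shows "integrable M u" "(LINT x|M. norm (u x)) \<le> l2_norm M (\<lambda>x. 1 :: real) * l2_norm M u"
proof -
  have one: "sconj (1 :: real) = 1" by (simp add: sconj_real_def)
  have "integrable M (\<lambda>x. norm (u x))"
    using integrable_mult_sconj[OF L2_norm[OF u] L2_one] by (simp add: one)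
  then show "integrable M u"
    using u by (simp add: integrable_norm_iff L2_def)
  have "re_part r = r" for r :: real using re_part_of_real[of r, where 'a=real] by simp
  then show "(LINT x|M. norm (u x)) \<le> l2_norm M (\<lambda>x. 1 :: real) * l2_norm M u"
    using l2_Cauchy_Schwarz[OF L2_norm[OF u] L2_one]
    by (simp add: l2_re_inner_integral[OF L2_norm[OF u] L2_one] one mult.commute)
qed

text \<open>Continuity on the compact square bounds the kernel. Dominated convergence makes every \<open>K u\<close>
  continuous, hence measurable, and Cauchy-Schwarz against the constant 1 bounds it uniformly.\<close>

lemma bounded_op_integral_op:
  fixes k :: "real \<Rightarrow> real \<Rightarrow> 'a::conj_scalar"
  assumes k: "continuous_on ({c..d} \<times> {c..d}) (\<lambda>(x, z). k x z)"
    and M_eq: "M = lebesgue_on {c..d}"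
  shows "bounded_op M (integral_op M k)"
proof -
  have space: "space M = {c..d}" by (simp add: M_eq)
  interpret finite_measure M
    unfolding M_eq by (rule finite_measure_lebesgue_on) simp
  define E where "E = l2_norm M (\<lambda>x. 1 :: real)"
  have "compact ((\<lambda>(x, z). k x z) ` ({c..d} \<times> {c..d}))"
    by (intro compact_continuous_image[OF k] compact_Times) auto
  then have "bounded ((\<lambda>(x, z). k x z) ` ({c..d} \<times> {c..d}))" by (rule compact_imp_bounded)
  then obtain B where B: "0 < B" and
    B_image: "\<forall>p\<in>(\<lambda>(x, z). k x z) ` ({c..d} \<times> {c..d}). norm p \<le> B"
    unfolding bounded_pos by blast
  have kB: "norm (k x z) \<le> B" if "x \<in> {c..d}" "z \<in> {c..d}" for x z
    using bspec[OF B_image, of "k x z"] that by force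
  have kuB: "norm (k x z * u z) \<le> B * norm (u z)" if "x \<in> {c..d}" "z \<in> space M" for x z u
    using mult_right_mono[OF kB[OF that(1)], of z "norm (u z)"] that(2) by (simp add: norm_mult space)
  have k_meas: "k x \<in> borel_measurable M" if x: "x \<in> {c..d}" for x
  proof -
    have "continuous_on {c..d} (\<lambda>z. (\<lambda>(x, z). k x z) (x, z))"
      by (rule continuous_on_compose2[OF k]) (auto intro!: continuous_intros x)
    then show ?thesis unfolding M_eq by (intro continuous_imp_measurable_on_sets_lebesgue) auto
  qed
  have ku: "integrable M (\<lambda>z. k x z * u z)" if x: "x \<in> {c..d}" and u: "u \<in> L2 M" for x u
  proof (rule Bochner_Integration.integrable_bound)
    show "integrable M (\<lambda>z. B * norm (u z))" using L2_integrable(1)[OF u] by simp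
    show "(\<lambda>z. k x z * u z) \<in> borel_measurable M"
      using k_meas[OF x] u by (auto simp: L2_def)
    show "AE z in M. norm (k x z * u z) \<le> norm (B * norm (u z))"
      by (intro AE_I2 order_trans[OF kuB[OF x]]) auto
  qed
  have cont: "continuous_on {c..d} (integral_op M k u)" if u: "u \<in> L2 M" for u
    unfolding continuous_on_sequentially
  proof (intro allI ballI impI, elim conjE)
    fix X x assume x: "x \<in> {c..d}" and X: "\<forall>i. X i \<in> {c..d}" and lim: "X \<longlonglongrightarrow> x"
    have "(\<lambda>i. LINT z|M. k (X i) z * u z) \<longlonglongrightarrow> (LINT z|M. k x z * u z)"
    proof (rule integral_dominated_convergence[where w = "\<lambda>z. B * norm (u z)"])
      show "integrable M (\<lambda>z. B * norm (u z))" using L2_integrable(1)[OF u] by simp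
      show "(\<lambda>z. k x z * u z) \<in> borel_measurable M" by (rule borel_measurable_integrable[OF ku[OF x u]])
      show "(\<lambda>z. k (X i) z * u z) \<in> borel_measurable M" for i
        by (rule borel_measurable_integrable[OF ku[OF X[rule_format] u]])
      show "AE z in M. norm (k (X i) z * u z) \<le> B * norm (u z)" for i
        by (intro AE_I2 kuB X[rule_format])
      show "AE z in M. (\<lambda>i. k (X i) z * u z) \<longlonglongrightarrow> k x z * u z"
      proof (rule AE_I2)
        fix z assume "z \<in> space M"
        then have z: "z \<in> {c..d}" by (simp add: space)
        have "(\<lambda>i. (X i, z)) \<longlonglongrightarrow> (x, z)" by (intro tendsto_intros lim)
        from continuous_on_tendsto_compose[OF k this]
        have "(\<lambda>i. k (X i) z) \<longlonglongrightarrow> k x z" using X x z by simp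
        then show "(\<lambda>i. k (X i) z * u z) \<longlonglongrightarrow> k x z * u z"
          by (intro tendsto_mult tendsto_const)
      qed
    qed
    then show "(integral_op M k u \<circ> X) \<longlonglongrightarrow> integral_op M k u x"
      by (simp add: integral_op_def o_def)
  qed
  have pointwise: "norm (integral_op M k u x) \<le> B * (E * l2_norm M u)"
    if u: "u \<in> L2 M" and x: "x \<in> {c..d}" for u x
  proof -
    have "norm (integral_op M k u x) \<le> (LINT z|M. B * norm (u z))"
      unfolding integral_op_def
    proof (rule Bochner_Integration.integral_norm_bound_integral[OF ku[OF x u]])
      show "integrable M (\<lambda>z. B * norm (u z))" using L2_integrable(1)[OF u] by simp
      show "norm (k x z * u z) \<le> B * norm (u z)" if "z \<in> space M" for z by (rule kuB[OF x that])
    qed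
    also have "\<dots> \<le> B * (E * l2_norm M u)"
      using L2_integrable(2)[OF u] B by (simp add: E_def)
    finally show ?thesis .
  qed
  have E: "0 \<le> E" by (simp add: E_def)
  have *: "integral_op M k u \<in> L2 M \<and> l2_norm M (integral_op M k u) \<le> (B * E * E) * l2_norm M u"
    if u: "u \<in> L2 M" for u
  proof -
    define b where "b = B * (E * l2_norm M u)"
    have b: "0 \<le> b" using B E by (simp add: b_def)
    have "(\<lambda>x. b * (1 :: real)) \<in> L2 M" by (rule L2_scale[OF L2_one])
    moreover have "integral_op M k u \<in> borel_measurable M"
      unfolding M_eq by (rule continuous_imp_measurable_on_sets_lebesgue[OF cont[OF u, unfolded M_eq]]) simp
    moreover have "AE x in M. norm (integral_op M k u x) \<le> norm (b * (1 :: real))"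
      using pointwise[OF u] b by (intro AE_I2) (simp add: space b_def)
    ultimately have "integral_op M k u \<in> L2 M"
      "l2_norm M (integral_op M k u) \<le> l2_norm M (\<lambda>x. b * (1 :: real))"
      using L2_dominated[of "integral_op M k u" M "\<lambda>x. b * (1 :: real)"] by blast+
    then show ?thesis
      unfolding l2_norm_scale using b by (simp add: b_def E_def mult_ac)
  qed
  show ?thesis
  proof (rule bounded_opI[where C = "B * E * E"])
    fix u v :: "real \<Rightarrow> 'a" and s :: 'a assume u: "u \<in> L2 M"
    show "integral_op M k u \<in> L2 M" "l2_norm M (integral_op M k u) \<le> (B * E * E) * l2_norm M u"
      using *[OF u] by auto
    show "l2_eq M (integral_op M k (\<lambda>x. s * u x)) (\<lambda>x. s * integral_op M k u x)"
      by (simp add: l2_eq_def integral_op_def mult.left_commute[of _ s])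
    assume v: "v \<in> L2 M"
    show "l2_eq M (integral_op M k (\<lambda>x. u x + v x)) (\<lambda>x. integral_op M k u x + integral_op M k v x)"
      unfolding l2_eq_def integral_op_def
      by (rule AE_I2) (simp add: distrib_left ku u v space)
  qed
qed

section \<open>Convergence of the iterative scheme\<close>

theorem theorem2p8:
  fixes c d :: real
    and k :: "real \<Rightarrow> real \<Rightarrow> 'a::conj_scalar"
    and M :: "real measure"
    and K Kadj T :: "(real \<Rightarrow> 'a) \<Rightarrow> (real \<Rightarrow> 'a)"
    and Tm Km :: "nat \<Rightarrow> (real \<Rightarrow> 'a) \<Rightarrow> (real \<Rightarrow> 'a)"
    and f y :: "real \<Rightarrow> 'a"
    and fd :: "real \<Rightarrow> real \<Rightarrow> 'a"
    and q \<alpha>0 :: real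
    and a :: "nat \<Rightarrow> real"
    and m :: "nat \<Rightarrow> nat"
    and n :: "real \<Rightarrow> nat"
  assumes interval: "c < d"
    and M_eq: "M = lebesgue_on {c..d}"
    and kernel: "smooth_kernel c d k"
    and K_eq: "K = integral_op M k"
    and adjoint: "is_adjoint M K Kadj"
    and T_eq: "T = Kadj \<circ> K"
    and f_L2: "f \<in> L2 M"
    and y_L2: "y \<in> L2 M"
    and solution: "l2_eq M (K y) f"
    and minimal_norm: "\<forall>v\<in>nullspace M K. l2_inner M y v = 0"
    and noise: "\<forall>\<delta>>0. fd \<delta> \<in> L2 M \<and> l2_norm M (\<lambda>x. fd \<delta> x - f x) \<le> \<delta>"
    and q: "0 < q" "q < 1"
    and \<alpha>0: "0 < \<alpha>0"
    and a_eq: "a = (\<lambda>i. \<alpha>0 * q ^ i)"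
    and Tm: "\<forall>l. bounded_op M (Tm l) \<and> finite_rank M (Tm l)"
    and Km: "\<forall>l. bounded_op M (Km l) \<and> finite_rank M (Km l)"
    and Tm_lim: "(\<lambda>l. op_norm M (op_diff (Tm l) T)) \<longlonglongrightarrow> 0"
    and Km_lim: "(\<lambda>l. op_norm M (op_diff (Km l) Kadj)) \<longlonglongrightarrow> 0"
    and m_T: "\<forall>i\<ge>1. op_norm M (op_diff T (Tm (m i))) \<le> a i / 2"
    and m_TK: "\<forall>i\<ge>1. op_norm M (op_diff (Tm (m i)) (Km (m i) \<circ> K)) \<le> (a i)\<^sup>2"
    and m_K: "\<forall>i\<ge>1. op_norm M (op_diff (Km (m i)) Kadj) \<le> sqrt (a i) / 2"
    and n_lim: "filterlim n at_top (at_right 0)"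
    and n_noise: "((\<lambda>\<delta>. \<delta> / sqrt (a (n \<delta>))) \<longlongrightarrow> 0) (at_right 0)"
  shows "((\<lambda>\<delta>. l2_norm M (\<lambda>x. iterate M q a Tm Km m (fd \<delta>) (n \<delta>) x - y x)) \<longlongrightarrow> 0) (at_right 0)"
proof -
  have a_pos: "0 < a i" for i using q \<alpha>0 by (simp add: a_eq)
  have "continuous_on ({c..d} \<times> {c..d}) (\<lambda>(x, z). k x z)"
  proof -
    obtain D :: "nat \<Rightarrow> nat \<Rightarrow> real \<Rightarrow> real \<Rightarrow> 'a"
      where D: "\<forall>x\<in>{c..d}. \<forall>z\<in>{c..d}. D 0 0 x z = k x z"
        and D_cont: "\<forall>i j. continuous_on ({c..d} \<times> {c..d}) (\<lambda>(x, z). D i j x z)"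
      using kernel unfolding smooth_kernel_def by blast
    from D D_cont[rule_format, of 0 0] show ?thesis
      by (subst continuous_on_cong[OF refl, of _ _ "\<lambda>(x, z). D 0 0 x z"]) auto
  qed
  then have K: "bounded_op M K" unfolding K_eq by (rule bounded_op_integral_op[OF _ M_eq])
  have Kadj: "bounded_op M Kadj" using adjoint by (simp add: is_adjoint_def)
  have T: "bounded_op M T" unfolding T_eq by (rule bounded_op_comp[OF Kadj K])
  have S: "bounded_op M (Tm l)" and R: "bounded_op M (Km l)" for l using Tm Km by auto
  have error: "l2_norm M (\<lambda>x. iterate M q a Tm Km m (fd \<delta>) i x - y x)
      \<le> 2 * \<delta> / sqrt (a i) + 2 * l2_norm M (\<lambda>x. y x - Kadj (K v) x)
        + q ^ i * (l2_norm M y + i * ((1 - q) * \<alpha>0 * (2 * l2_norm M y + 4 * l2_norm M v)))"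
    if \<delta>: "0 < \<delta>" and v: "v \<in> L2 M" for \<delta> i v
  proof -
    define w where "w j = op_inv M (op_shift (Tm (m j)) (a j)) (Km (m j) (fd \<delta>))" for j
    define \<epsilon> where "\<epsilon> = 2 * l2_norm M (\<lambda>x. y x - Kadj (K v) x)"
    define C where "C = 2 * l2_norm M y + 4 * l2_norm M v"
    have fd: "fd \<delta> \<in> L2 M" "l2_norm M (\<lambda>x. fd \<delta> x - f x) \<le> \<delta>" using noise \<delta> by auto
    have w: "w j \<in> L2 M \<and> l2_norm M (\<lambda>x. w j x - y x) \<le> 2 * \<delta> / sqrt (a j) + \<epsilon> + a j * C"
      if j: "1 \<le> j" for j
    proof -
      have dS: "l2_norm M (\<lambda>x. Kadj (K u) x - Tm (m j) u x) \<le> a j / 2 * l2_norm M u"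
        if "u \<in> L2 M" for u
        using op_norm_op_diff_bound[OF T S m_T[rule_format, OF j] that] by (simp add: T_eq)
      have dSR: "l2_norm M (\<lambda>x. Tm (m j) u x - Km (m j) (K u) x) \<le> (a j)\<^sup>2 * l2_norm M u"
        if "u \<in> L2 M" for u
        using op_norm_op_diff_bound[OF S bounded_op_comp[OF R K] m_TK[rule_format, OF j] that] by simp
      have dR: "l2_norm M (\<lambda>x. Km (m j) u x - Kadj u x) \<le> sqrt (a j) / 2 * l2_norm M u"
        if "u \<in> L2 M" for u
        by (rule op_norm_op_diff_bound[OF R Kadj m_K[rule_format, OF j] that])
      note reg = regularized_solution_error[OF K adjoint a_pos S R dS dSR dR y_L2 v f_L2 fd(1) solution w_def]
      have "2 * l2_norm M (\<lambda>x. fd \<delta> x - f x) / sqrt (a j) \<le> 2 * \<delta> / sqrt (a j)"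
        using fd(2) a_pos[of j] by (intro divide_right_mono mult_left_mono) auto
      then show ?thesis using reg unfolding \<epsilon>_def C_def by auto
    qed
    show ?thesis
      using iterate_error[OF q \<alpha>0 a_eq, of "2 * \<delta>" \<epsilon> y M Tm m Km "fd \<delta>" C i] w \<delta> y_L2
      unfolding w_def \<epsilon>_def C_def by simp
  qed
  show ?thesis
  proof (rule tendstoI)
    fix e :: real assume e: "0 < e"
    \<comment> \<open>\<open>v\<close> is fixed before \<open>\<delta>\<close> tends to 0: its norm may be large, but it enters the bound only through \<open>B\<close>.\<close>
    obtain v where v: "v \<in> L2 M" and v_near: "l2_norm M (\<lambda>x. y x - Kadj (K v) x) < e / 2"
      using orthogonal_nullspace_approx[OF K adjoint y_L2 minimal_norm, of "e / 2"] e by auto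
    define \<epsilon> where "\<epsilon> = 2 * l2_norm M (\<lambda>x. y x - Kadj (K v) x)"
    define B where "B = (1 - q) * \<alpha>0 * (2 * l2_norm M y + 4 * l2_norm M v)"
    have "(\<lambda>i. l2_norm M y * q ^ i + B * (of_nat i * q ^ i)) \<longlonglongrightarrow> l2_norm M y * 0 + B * 0"
      using q by (intro tendsto_intros LIMSEQ_realpow_zero powser_times_n_limit_0) auto
    then have "(\<lambda>i. q ^ i * (l2_norm M y + i * B)) \<longlonglongrightarrow> 0"
      by (simp add: algebra_simps)
    then have "((\<lambda>\<delta>. q ^ n \<delta> * (l2_norm M y + n \<delta> * B)) \<longlongrightarrow> 0) (at_right 0)"
      using n_lim by (rule filterlim_compose)
    then have "((\<lambda>\<delta>. 2 * (\<delta> / sqrt (a (n \<delta>))) + \<epsilon> + q ^ n \<delta> * (l2_norm M y + n \<delta> * B))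
        \<longlongrightarrow> 2 * 0 + \<epsilon> + 0) (at_right 0)"
      by (intro tendsto_intros n_noise)
    moreover have "2 * 0 + \<epsilon> + 0 < e" using v_near by (simp add: \<epsilon>_def)
    ultimately have "\<forall>\<^sub>F \<delta> in at_right 0.
        2 * (\<delta> / sqrt (a (n \<delta>))) + \<epsilon> + q ^ n \<delta> * (l2_norm M y + n \<delta> * B) < e"
      by (rule order_tendstoD(2))
    then show "\<forall>\<^sub>F \<delta> in at_right 0.
        dist (l2_norm M (\<lambda>x. iterate M q a Tm Km m (fd \<delta>) (n \<delta>) x - y x)) 0 < e"
      using eventually_at_right_less[of "0 :: real"]
    proof eventually_elim
      case (elim \<delta>)
      then show ?case
        using error[OF elim(2) v, of "n \<delta>"] by (simp add: \<epsilon>_def B_def)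
    qed
  qed
qed

end
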